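(* Let $\mathbf{K}=\mathbf{R}$ (real case) or $\mathbf{K}=\mathbf{C}$ (complex case), and let $x_0\in\mathbf{K}^n$ be nonzero. Let $A\in\mathbf{K}^{N\times n}$ be a random standardized matrix (i.e. $A^\top A=I_{n\times n}$) drawn from a continuous distribution on the set of standardized matrices, where $N\ge 2n-1$ in the real case and $N\ge 4n-2$ in the complex case. Let $b=|Ax_0|$ and consider the problem $$\min_X\ -\sigma_1(X)\quad\text{subject to } X \text{ Hermitian positive semidefinite and } \mathcal{A}(X)=b^2 .$$ Then with probability one, a feasible matrix $X$ attains the global minimum if and only if $X=x_0x_0^\top$.
   Context: $^\top$ denotes the conjugate transpose (the transpose in the real case). $|Ax_0|$ is the vector of entrywise moduli of $Ax_0$ and $b^2$ is the entrywise square of $b$. $\sigma_1(X)$ denotes the largest eigenvalue of the Hermitian matrix $X\in\mathbf{K}^{n\times n}$. The linear operator $\mathcal{A}$ maps a Hermitian $n\times n$ matrix $X$ to $\mathcal{A}(X)=\mathrm{diag}(AXA^\top)\in\mathbf{R}^N$, the vector of diagonal entries of $AXA^\top$; in particular $\mathcal{A}(xx^\top)=|Ax|^2$ entrywise. A matrix $A\in\mathbf{K}^{N\times n}$ is called standardized if $A^\top A=I_{n\times n}$. "Continuous distribution" means absolutely continuous with respect to the invariant (Haar) measure on the Stiefel manifold $\{A\in\mathbf{K}^{N\times n}:A^\top A=I_{n\times n}\}$. *)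

theory Defs
  imports "HOL-Probability.Probability" "Jordan_Normal_Form.Conjugate"
begin

text \<open>
  The definitions are polymorphic over the scalar field \<open>'k\<close> and are meant to be used at
  \<open>'k = real\<close>, where \<open>conjugate\<close> is the identity, and at \<open>'k = complex\<close>, where it is \<open>cnj\<close>.
  An \<open>N \<times> n\<close> matrix over \<open>'k\<close> has type \<open>'k^'n^'m\<close> with \<open>CARD('m) = N\<close> and \<open>CARD('n) = n\<close>.
\<close>

definition ctranspose :: "('k::conjugate)^'n^'m \<Rightarrow> 'k^'m^'n" where
  "ctranspose A = (\<chi> i j. conjugate (A $ j $ i))"

definition hermitian_form :: "('k::conjugatable_field)^'n^'n \<Rightarrow> 'k^'n \<Rightarrow> 'k" where
  "hermitian_form X v = (\<Sum>i\<in>UNIV. conjugate (v $ i) * (X *v v) $ i)"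

definition hermitian_psd :: "('k::{conjugatable_field,real_normed_field})^'n^'n \<Rightarrow> bool" where
  "hermitian_psd X \<longleftrightarrow> ctranspose X = X \<and> (\<forall>v. hermitian_form X v \<in> \<real>\<^sub>\<ge>\<^sub>0)"

text \<open>
  Used on Hermitian matrices only: their eigenvalues are real, and the set below is finite and
  nonempty, so that \<open>Max\<close> is meaningful.
\<close>

definition sigma1 :: "('k::real_normed_field)^'n^'n \<Rightarrow> real" where
  "sigma1 X = Max {t. \<exists>v. v \<noteq> 0 \<and> X *v v = of_real t *s v}"

definition outer_square :: "('k::conjugatable_field)^'n \<Rightarrow> 'k^'n^'n" where
  "outer_square x = (\<chi> i j. x $ i * conjugate (x $ j))"

definition vec_modulus :: "('k::real_normed_field)^'m \<Rightarrow> real^'m" where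
  "vec_modulus y = (\<chi> i. norm (y $ i))"

text \<open>
  The values are kept in \<open>'k\<close>; for Hermitian \<open>X\<close> they are real, i.e. in the image of \<open>of_real\<close>.
\<close>

definition lifted_op :: "('k::conjugatable_field)^'n^'m \<Rightarrow> 'k^'n^'n \<Rightarrow> 'k^'m" where
  "lifted_op A X = (\<chi> i. (A ** X ** ctranspose A) $ i $ i)"

definition feasible ::
  "('k::{conjugatable_field,real_normed_field})^'n^'m \<Rightarrow> real^'m \<Rightarrow> 'k^'n^'n \<Rightarrow> bool" where
  "feasible A b X \<longleftrightarrow> hermitian_psd X \<and> lifted_op A X = (\<chi> i. of_real ((b $ i)\<^sup>2))"

definition global_minimizer ::
  "('k::{conjugatable_field,real_normed_field})^'n^'m \<Rightarrow> real^'m \<Rightarrow> 'k^'n^'n \<Rightarrow> bool" where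
  "global_minimizer A b = is_arg_min (\<lambda>X. - sigma1 X) (feasible A b)"

definition standardized :: "('k::conjugatable_field)^'n^'m \<Rightarrow> bool" where
  "standardized A \<longleftrightarrow> ctranspose A ** A = mat 1"

definition unitary_matrix :: "('k::conjugatable_field)^'m^'m \<Rightarrow> bool" where
  "unitary_matrix U \<longleftrightarrow> ctranspose U ** U = mat 1 \<and> U ** ctranspose U = mat 1"

text \<open>
  The Haar measure of the Stiefel manifold: the Borel probability measure on it that is invariant
  under the transitive action \<open>A \<mapsto> U A\<close> of the compact orthogonal (unitary) group. Existence and
  uniqueness are classical, hence the invariance is used as a characterization.
\<close>

definition stiefel_haar ::
  "(('k::{conjugatable_field,real_normed_field})^'n^'m) measure \<Rightarrow> bool" where
  "stiefel_haar \<mu> \<longleftrightarrow>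
     sets \<mu> = sets (restrict_space borel {A. standardized A}) \<and>
     prob_space \<mu> \<and>
     (\<forall>U. unitary_matrix U \<longrightarrow> distr \<mu> \<mu> (\<lambda>A. U ** A) = \<mu>)"

text \<open>
  A random standardized matrix, i.e. a random variable on \<open>M\<close> with values in the Stiefel manifold,
  whose law is absolutely continuous with respect to the Haar measure.
\<close>

definition continuous_random_standardized ::
  "'w measure \<Rightarrow> ('w \<Rightarrow> ('k::{conjugatable_field,real_normed_field})^'n^'m) \<Rightarrow> bool" where
  "continuous_random_standardized M A \<longleftrightarrow>
     (\<exists>\<mu>. stiefel_haar \<mu> \<and> A \<in> measurable M \<mu> \<and> absolutely_continuous \<mu> (distr M \<mu> A))"

end

theory Submission
  imports Defs
begin

text \<open>
  Write \<open>N\<close> and \<open>n\<close> for the numbers of rows and columns of \<open>A\<close>.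

  \<^bold>\<open>Reduction to phase retrieval.\<close> A standardized \<open>A\<close> is an isometry, so the diagonal of
  \<open>A X A\<^sup>*\<close> sums to the trace of \<open>X\<close>, and every feasible \<open>X\<close> has trace \<open>\<parallel>x\<^sub>0\<parallel>\<^sup>2\<close>. The largest eigenvalue of a
  positive semidefinite matrix is at most its trace, with equality only in rank at most one
  (\<open>psd_sigma1_trace\<close>). Hence \<open>x\<^sub>0 x\<^sub>0\<^sup>*\<close> always attains the minimum, and any minimizer is some
  \<open>x x\<^sup>*\<close> with \<open>\<bar>A x\<bar> = \<bar>A x\<^sub>0\<bar>\<close>. What remains is that, almost surely, such an \<open>x\<close> is a multiple of
  \<open>x\<^sub>0\<close>; the multiple is then unimodular and \<open>x x\<^sup>* = x\<^sub>0 x\<^sub>0\<^sup>*\<close>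
  (\<open>minimizer_iff_if_phase_retrieval\<close>).

  \<^bold>\<open>Dimension count.\<close> Choose a basis \<open>g\<^sub>1, \<dots>, g\<^sub>n\<close> of the range of \<open>A\<close> with \<open>g\<^sub>1\<close> parallel to
  \<open>A x\<^sub>0\<close>. If \<open>\<bar>A x\<bar> = \<bar>A x\<^sub>0\<bar>\<close> but \<open>x\<close> is no multiple of \<open>x\<^sub>0\<close>, then \<open>D g\<^sub>1\<close> lies in the range for a
  diagonal \<open>D\<close> of unimodular entries, and its expansion involves some \<open>g\<^sub>j\<close> with \<open>j \<noteq> 1\<close>. Solving for
  \<open>g\<^sub>j\<close> puts this vector into the set of all combinations of \<open>D g\<^sub>1\<close> and the other \<open>g\<^sub>l\<close>. For given
  \<open>g\<^sub>l\<close> this set has \<open>n\<close> scalar parameters besides \<open>D\<close>: in the complex case it is a smooth image of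
  \<open>\<real>\<close>-dimension \<open>N + 2n\<close> in dimension \<open>2N\<close>, in the real case a finite union of linear images of
  dimension \<open>n\<close> in dimension \<open>N\<close>. For \<open>n \<ge> 2\<close> the bounds on \<open>N\<close> give \<open>N > 2n\<close> and \<open>N > n\<close>
  respectively, so \<open>g\<^sub>j\<close> is confined to a null set; for \<open>n = 1\<close> all vectors are multiples of \<open>x\<^sub>0\<close>.

  \<^bold>\<open>Haar null sets from Lebesgue null sets.\<close> The count concerns Lebesgue measure on the columns of a
  square matrix \<open>G\<close>. Gram-Schmidt turns \<open>G\<close> into a unitary \<open>Q(G)\<close> such that the leading columns keep
  their span and \<open>Q(U G) = U Q(G)\<close>. If \<open>Q(G) A\<^sub>0 \<notin> Z\<close> for almost all \<open>G\<close>, with one fixed \<open>A\<^sub>0\<close>, then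
  \<open>Z\<close> is null for every probability measure on the standardized matrices that is invariant under left
  multiplication by unitary matrices
  (\<open>AE_stiefel_haar_if_AE_gram_schmidt\<close>): this is the usual proof that an invariant measure is
  unique, carried out for null sets only, so that Lebesgue measure can replace a probability on the
  unitary group.
\<close>

section \<open>Scalars that are real or complex\<close>

text \<open>
  The two cases of the theorem are treated at once. Conjugation and the Euclidean structure of
  the scalars are linked by one axiom: the inner product is the real part of \<open>conjugate x * y\<close>, which
  is expressed here by the symmetrized product.
\<close>

class rc_field = conjugatable_field + real_normed_field + euclidean_space +
  assumes conjugate_inner: "conjugate x * y + conjugate y * x = scaleR (2 * inner x y) 1"

instance real :: rc_field
  by standard simp

instance complex :: rc_field
  by standard (simp add: complex_eq_iff inner_complex_def)

lemma two_of_real_inner: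
  "2 * of_real (inner x y) = conjugate x * y + conjugate y * (x::'k::rc_field)"
proof -
  have "2 * of_real (inner x y) = (of_real (2 * inner x y) :: 'k)" by simp
  then show ?thesis by (simp only: conjugate_inner of_real_def)
qed

lemma conjugate_one [simp]: "conjugate (1::'k::rc_field) = 1"
proof -
  have "conjugate (1::'k) * conjugate 1 = conjugate 1"
    by (metis conjugate_dist_mul mult_1)
  moreover have "conjugate (1::'k) \<noteq> 0" by simp
  ultimately show ?thesis by simp
qed

lemma conjugate_of_real [simp]: "conjugate (of_real r :: 'k::rc_field) = of_real r"
proof -
  have "inner (1::'k) (of_real r) = r"
    by (simp add: of_real_def dot_square_norm)
  then have "of_real r + of_real r = of_real r + conjugate (of_real r :: 'k)"
    using two_of_real_inner[of "1::'k" "of_real r"] unfolding mult_2 by simp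
  then show ?thesis by (metis add_left_cancel)
qed

lemma conjugate_mult_self: "conjugate x * x = of_real ((norm (x::'k::rc_field))\<^sup>2)"
proof -
  have "2 * of_real ((norm x)\<^sup>2) = 2 * (conjugate x * x)"
    using two_of_real_inner[of x x] unfolding dot_square_norm mult_2 .
  then show ?thesis by simp
qed

lemma of_real_power2_eqD:
  assumes "of_real (a\<^sup>2) = (of_real (b\<^sup>2) :: 'k::real_algebra_1)" "0 \<le> a" "0 \<le> b"
  shows "a = b"
proof -
  have "a\<^sup>2 = b\<^sup>2" using assms(1) of_real_eq_iff by blast
  then show ?thesis using assms(2,3) by (rule power2_eq_imp_eq)
qed

lemma norm_conjugate [simp]: "norm (conjugate x) = norm (x::'k::rc_field)"
proof -
  have "of_real ((norm (conjugate x))\<^sup>2) = (of_real ((norm x)\<^sup>2) :: 'k)"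
    unfolding conjugate_mult_self[symmetric] by (simp add: mult.commute)
  then show ?thesis by (rule of_real_power2_eqD) simp_all
qed

lemma conjugate_diff: "conjugate (x - y) = conjugate x - conjugate (y::'k::rc_field)"
  using conjugate_dist_add[of x "- y"] by (simp add: conjugate_neg)

lemma bounded_linear_conjugate: "bounded_linear (conjugate :: 'k::rc_field \<Rightarrow> 'k)"
proof (rule bounded_linear_intro[where K = 1])
  show "conjugate (r *\<^sub>R x) = r *\<^sub>R conjugate x" for r and x :: 'k
    by (simp add: scaleR_conv_of_real conjugate_dist_mul)
  show "conjugate (x + y) = conjugate x + conjugate y" for x y :: 'k
    by (rule conjugate_dist_add)
  show "norm (conjugate x) \<le> norm x * 1" for x :: 'k by simp
qed

lemmas continuous_on_conjugate [continuous_intros] =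
  bounded_linear.continuous_on[OF bounded_linear_conjugate]

definition cinner :: "'k::rc_field^'n \<Rightarrow> 'k^'n \<Rightarrow> 'k" where
  "cinner v w = (\<Sum>i\<in>UNIV. conjugate (v $ i) * w $ i)"

lemma cinner_add_left: "cinner (u + v) w = cinner u w + cinner v w"
  by (simp add: cinner_def conjugate_dist_add distrib_right sum.distrib)
lemma cinner_add_right: "cinner u (v + w) = cinner u v + cinner u w"
  by (simp add: cinner_def distrib_left sum.distrib)
lemma cinner_diff_left: "cinner (u - v) w = cinner u w - cinner v w"
  by (simp add: cinner_def conjugate_diff left_diff_distrib sum_subtractf)
lemma cinner_diff_right: "cinner u (v - w) = cinner u v - cinner u w"
  by (simp add: cinner_def right_diff_distrib sum_subtractf)
lemma cinner_scale_left: "cinner (c *s u) v = conjugate c * cinner u v"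
  by (simp add: cinner_def conjugate_dist_mul sum_distrib_left mult.assoc)
lemma cinner_scale_right: "cinner u (c *s v) = c * cinner u v"
  by (simp add: cinner_def sum_distrib_left algebra_simps)
lemma cinner_zero [simp]: "cinner 0 v = 0" "cinner v 0 = 0"
  by (simp_all add: cinner_def)
lemma conjugate_cinner: "conjugate (cinner v w) = cinner w v"
  by (simp add: cinner_def sum_conjugate conjugate_dist_mul mult.commute)
lemma cinner_self: "cinner v v = of_real ((norm v)\<^sup>2)"
  by (simp add: cinner_def conjugate_mult_self norm_vec_def L2_set_def sum_nonneg)

lemmas cinner_simps = cinner_add_left cinner_add_right cinner_diff_left cinner_diff_right
  cinner_scale_left cinner_scale_right

lemma cinner_axis [simp]: "cinner (axis i 1) v = v $ i"
  by (simp add: cinner_def axis_def if_distrib[of conjugate] if_distrib[of "\<lambda>x. x * _"] cong: if_cong)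

lemma cinner_mult_left: "cinner (A *v x) y = cinner x (ctranspose A *v y)"
proof -
  have "cinner (A *v x) y = (\<Sum>i\<in>UNIV. \<Sum>j\<in>UNIV. conjugate (A $ i $ j) * conjugate (x $ j) * y $ i)"
    by (simp add: cinner_def matrix_vector_mult_def sum_conjugate conjugate_dist_mul sum_distrib_right)
  also have "\<dots> = (\<Sum>j\<in>UNIV. \<Sum>i\<in>UNIV. conjugate (A $ i $ j) * conjugate (x $ j) * y $ i)"
    by (rule sum.swap)
  also have "\<dots> = cinner x (ctranspose A *v y)"
    by (simp add: cinner_def matrix_vector_mult_def ctranspose_def sum_distrib_left algebra_simps)
  finally show ?thesis .
qed

lemma two_of_real_inner_vec:
  "2 * of_real (inner v w) = cinner v w + cinner w (v :: 'k::rc_field^'n)"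
  by (simp add: inner_vec_def cinner_def sum_distrib_left two_of_real_inner flip: sum.distrib)

lemma ctranspose_ctranspose [simp]: "ctranspose (ctranspose A) = (A :: 'k::rc_field^'n^'m)"
  by (simp add: ctranspose_def vec_eq_iff)

lemma ctranspose_mult: "ctranspose (A ** B) = ctranspose B ** ctranspose (A :: 'k::rc_field^'n^'m)"
  by (simp add: ctranspose_def vec_eq_iff matrix_matrix_mult_def sum_conjugate conjugate_dist_mul mult.commute)

lemma ctranspose_one [simp]: "ctranspose (mat 1) = (mat 1 :: 'k::rc_field^'n^'n)"
  by (simp add: ctranspose_def vec_eq_iff mat_def)

lemma vec_norm_scale: "norm (c *s v) = norm c * norm (v :: 'k::rc_field^'n)"
proof -
  have "norm ((c *s v) $ i) = norm c * norm (v $ i)" for i by (simp add: norm_mult)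
  then show ?thesis by (simp add: norm_vec_def L2_set_right_distrib)
qed

lemma of_real_scale: "of_real r *s v = r *\<^sub>R (v :: 'k::rc_field^'n)"
  by (simp add: vec_eq_iff) (simp add: scaleR_conv_of_real)

section \<open>Isometries and reflections\<close>

lemma standardized_cinner:
  assumes "standardized A" shows "cinner (A *v x) (A *v y) = cinner x (y :: 'k::rc_field^'n)"
  using assms by (simp add: cinner_mult_left matrix_vector_mul_assoc standardized_def)

lemma standardized_norm:
  assumes "standardized A" shows "norm (A *v x) = norm (x :: 'k::rc_field^'n)"
proof -
  have "of_real ((norm (A *v x))\<^sup>2) = (of_real ((norm x)\<^sup>2) :: 'k)"
    using standardized_cinner[OF assms, of x x] by (simp add: cinner_self)
  then show ?thesis by (rule of_real_power2_eqD) simp_all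
qed

lemma standardizedI:
  assumes "\<And>i j. cinner (A *v axis i 1) (A *v axis j 1) = (if i = j then 1 else 0)"
  shows "standardized (A :: 'k::rc_field^'n^'m)"
proof -
  have "(ctranspose A ** A) $ i $ j = cinner (A *v axis i 1) (A *v axis j 1)" for i j
    by (simp add: cinner_mult_left matrix_vector_mul_assoc) (simp add: matrix_vector_mult_def axis_def
        if_distrib[of "\<lambda>x. _ * x"] cong: if_cong)
  then show ?thesis using assms by (simp add: standardized_def vec_eq_iff mat_def)
qed

lemma standardized_imp_unitary:
  assumes "standardized (U :: 'k::rc_field^'m^'m)" shows "unitary_matrix U"
  using assms matrix_left_right_inverse by (auto simp: standardized_def unitary_matrix_def)

lemma unitary_imp_standardized: "unitary_matrix U \<Longrightarrow> standardized U"
  by (simp add: standardized_def unitary_matrix_def)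

lemma unitary_ctranspose: "unitary_matrix (U :: 'k::rc_field^'m^'m) \<Longrightarrow> unitary_matrix (ctranspose U)"
  by (simp add: unitary_matrix_def)

lemma standardized_mult:
  assumes "standardized A" "standardized B"
  shows "standardized ((A :: 'k::rc_field^'n^'m) ** (B :: 'k^'p^'n))"
proof -
  have "ctranspose B ** ctranspose A ** (A ** B) = ctranspose B ** (ctranspose A ** A) ** B"
    by (simp add: matrix_mul_assoc)
  then show ?thesis using assms by (simp add: standardized_def ctranspose_mult)
qed

lemma unitary_mult:
  "unitary_matrix U \<Longrightarrow> unitary_matrix V \<Longrightarrow> unitary_matrix ((U :: 'k::rc_field^'m^'m) ** V)"
  by (simp add: standardized_imp_unitary standardized_mult unitary_imp_standardized)

lemma unitary_one: "unitary_matrix (mat 1 :: 'k::rc_field^'m^'m)"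
  by (simp add: unitary_matrix_def)

text \<open>
  The complex Householder map \<open>z \<mapsto> z - (\<langle>w, z\<rangle> / \<langle>w, u\<rangle>) w\<close> with \<open>w = u - v\<close>. It sends \<open>u\<close> to
  \<open>u - w = v\<close>. Equality of the norms of \<open>u\<close> and \<open>v\<close> gives \<open>\<langle>w, w\<rangle> = 2 Re \<langle>w, u\<rangle>\<close>, which is exactly the
  condition for the map to preserve inner products.
\<close>

lemma householder:
  fixes u v :: "'k::rc_field^'m"
  assumes "norm u = norm v"
  obtains H where "unitary_matrix H" "H *v u = v" "\<And>z. cinner (u - v) z = 0 \<Longrightarrow> H *v z = z"
proof (cases "u = v")
  case True
  then show ?thesis using that[of "mat 1"] unitary_one by auto
next
  case False
  define w where "w = u - v"
  define \<alpha> where "\<alpha> = cinner w u"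
  define H :: "'k^'m^'m" where "H = (\<chi> i j. (if i = j then 1 else 0) - w $ i * conjugate (w $ j) / \<alpha>)"
  have "cinner u u = cinner v v" using assms by (simp add: cinner_self)
  then have wv: "cinner w v = - conjugate \<alpha>"
    by (simp add: w_def \<alpha>_def conjugate_cinner cinner_diff_left cinner_diff_right conjugate_diff)
  have "cinner w w = cinner w u - cinner w v"
    by (subst (2) w_def) (rule cinner_diff_right)
  then have ww: "cinner w w = \<alpha> + conjugate \<alpha>"
    by (simp only: wv \<alpha>_def[symmetric]) simp
  have "cinner w w \<noteq> 0" using False by (simp add: w_def cinner_self)
  have \<alpha>: "\<alpha> \<noteq> 0"
  proof
    assume "\<alpha> = 0"
    then have "cinner w w = 0" using ww by (simp only: conjugate_zero add_0)
    with \<open>cinner w w \<noteq> 0\<close> show False by contradiction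
  qed
  have H: "H *v z = z - (cinner w z / \<alpha>) *s w" for z
  proof -
    have "(H *v z) $ i = (\<Sum>j\<in>UNIV. (if i = j then z $ j else 0) - w $ i / \<alpha> * (conjugate (w $ j) * z $ j))" for i
      unfolding matrix_vector_mult_def H_def by (auto intro!: sum.cong simp: left_diff_distrib)
    then have "(H *v z) $ i = z $ i - w $ i / \<alpha> * cinner w z" for i
      by (simp only: sum_subtractf cinner_def flip: sum_distrib_left) simp
    then show ?thesis by (simp add: vec_eq_iff mult.commute)
  qed
  have "cinner (H *v x) (H *v y) = cinner x y" for x y
  proof -
    define a b where "a = cinner w x / \<alpha>" and "b = cinner w y / \<alpha>"
    have a: "cinner x w = conjugate a * conjugate \<alpha>"
      using \<alpha> by (metis a_def conjugate_cinner conjugate_dist_mul nonzero_divide_eq_eq)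
    have b: "cinner w y = b * \<alpha>" using \<alpha> by (simp add: b_def)
    have "cinner (H *v x) (H *v y) = cinner (x - a *s w) (y - b *s w)"
      by (simp add: H a_def b_def)
    also have "\<dots> = cinner x y" by (simp add: cinner_simps a b ww algebra_simps)
    finally show ?thesis .
  qed
  then have "standardized H"
    by (intro standardizedI) (simp, simp add: axis_def)
  moreover have "H *v u = v" using \<alpha> by (simp add: H \<alpha>_def[symmetric]) (simp add: w_def)
  ultimately show ?thesis using that[of H] by (simp add: standardized_imp_unitary H w_def)
qed

lemma matrix_vector_mult_axis: "A *v axis j 1 = column j (A :: 'k::rc_field^'n^'m)"
  by (simp add: vec_eq_iff column_def matrix_vector_mult_def axis_def if_distrib[of "\<lambda>x. _ * x"] cong: if_cong)

lemma matrix_eq_columns: "A = B \<longleftrightarrow> (\<forall>j. A *v axis j 1 = B *v axis j (1::'k::rc_field))"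
  by (simp add: vec_eq_iff matrix_vector_mult_axis column_def) blast

text \<open>
  Columns are matched one after the other by reflections. The vector along which the \<open>k\<close>-th column is
  reflected is orthogonal to the columns treated before, so these stay fixed.
\<close>

lemma standardized_transitive:
  fixes A B :: "'k::rc_field^'n^'m"
  assumes "standardized A" "standardized B"
  obtains V where "unitary_matrix V" "V ** A = B"
proof -
  have "\<exists>V. unitary_matrix V \<and> (\<forall>j\<in>F. V *v (A *v axis j 1) = B *v axis j 1)" if "finite F" for F
    using that
  proof (induction F)
    case empty
    then show ?case using unitary_one by auto
  next
    case (insert k F)
    then obtain V where V: "unitary_matrix V" "\<forall>j\<in>F. V *v (A *v axis j 1) = B *v axis j 1" by auto
    define u v where "u = V *v (A *v axis k 1)" and "v = B *v axis k 1"
    have "norm u = norm v"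
      using V(1) assms by (simp add: u_def v_def standardized_norm unitary_imp_standardized)
    then obtain H where H: "unitary_matrix H" "H *v u = v" "\<And>z. cinner (u - v) z = 0 \<Longrightarrow> H *v z = z"
      using householder by blast
    have "H *v (V *v (A *v axis j 1)) = B *v axis j 1" if "j \<in> F" for j
    proof -
      have "j \<noteq> k" using that insert by auto
      have "cinner u (B *v axis j 1) = cinner u (V *v (A *v axis j 1))"
        using V(2) that by simp
      also have "\<dots> = 0" using V(1) assms(1) \<open>j \<noteq> k\<close>
        by (simp add: u_def standardized_cinner unitary_imp_standardized) (simp add: axis_def)
      finally have "cinner (u - v) (B *v axis j 1) = 0"
        using assms(2) \<open>j \<noteq> k\<close> by (simp add: v_def cinner_simps standardized_cinner) (simp add: axis_def)
      then show ?thesis using H(3) V(2) that by auto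
    qed
    then show ?case using H(1,2) V(1)
      by (intro exI[of _ "H ** V"]) (auto simp: unitary_mult u_def v_def simp flip: matrix_vector_mul_assoc)
  qed
  from this[of UNIV] obtain V where V: "unitary_matrix V" "\<And>j. V *v (A *v axis j 1) = B *v axis j 1"
    by auto
  have "V ** A = B"
    by (simp add: matrix_eq_columns V(2) flip: matrix_vector_mul_assoc)
  then show ?thesis using that V by auto
qed

section \<open>Largest eigenvalue and trace\<close>

text \<open>
  At a zero \<open>v\<close> of the nonnegative form the form is minimal; along \<open>v + s w\<close> with \<open>w = Y v\<close> it equals
  \<open>2 s \<parallel>w\<parallel>\<^sup>2 + s\<^sup>2 \<langle>w, Y w\<rangle>\<close>, which is negative for small \<open>s < 0\<close> unless \<open>w = 0\<close>.
\<close>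

lemma semidefinite_kernel:
  fixes Y :: "'a::real_inner \<Rightarrow> 'a"
  assumes lin: "linear Y" and sym: "\<And>u v. inner (Y u) v = inner u (Y v)"
    and nonneg: "\<And>u. 0 \<le> inner u (Y u)" and v: "inner v (Y v) = 0"
  shows "Y v = 0"
proof -
  define w a c where "w = Y v" and "a = inner w w" and "c = inner w (Y w)"
  have "c \<ge> 0" using nonneg by (simp add: c_def)
  define s where "s = - a / (c + 1)"
  have "inner v (Y w) = a" using sym[of v w] by (simp add: a_def w_def)
  then have "inner (v + s *\<^sub>R w) (Y (v + s *\<^sub>R w)) = 2 * s * a + s\<^sup>2 * c"
    using v by (simp add: linear_add[OF lin] linear_scale[OF lin] inner_add_left inner_add_right
        a_def c_def flip: w_def) (simp add: power2_eq_square algebra_simps)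
  also have "\<dots> = - (a\<^sup>2 * (c + 2) / (c + 1)\<^sup>2)"
    using \<open>c \<ge> 0\<close> by (simp add: s_def divide_simps power2_eq_square) (simp add: algebra_simps)
  finally have "a\<^sup>2 * (c + 2) / (c + 1)\<^sup>2 \<le> 0"
    using nonneg[of "v + s *\<^sub>R w"] by linarith
  moreover have "(c + 2) / (c + 1)\<^sup>2 > 0" using \<open>c \<ge> 0\<close> by (simp add: divide_simps)
  ultimately have "a\<^sup>2 \<le> 0"
    by (metis mult_le_0_iff not_less times_divide_eq_right)
  then show ?thesis by (simp add: a_def w_def)
qed

lemma linear_matrix_vector: "linear ((*v) (A :: 'k::rc_field^'n^'m))"
  by (rule linearI)
    (simp_all add: matrix_vector_right_distrib vector_scalar_commute flip: of_real_scale)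

lemma scaleR_entry: "(r *\<^sub>R M) $ i $ j = of_real r * (M :: 'k::rc_field^'n^'m) $ i $ j"
  by simp (simp add: scaleR_conv_of_real)

lemma scaleR_mult_vec: "(r *\<^sub>R M) *v x = r *\<^sub>R ((M :: 'k::rc_field^'n^'m) *v x)"
  by (simp add: vec_eq_iff matrix_vector_mult_def scaleR_sum_right)

lemma hermitian_inner:
  assumes "ctranspose X = X" shows "inner (X *v u) v = inner u (X *v (v :: 'k::rc_field^'n))"
proof -
  have "2 * of_real (inner (X *v u) v) = (2 * of_real (inner u (X *v v)) :: 'k)"
    by (simp only: two_of_real_inner_vec cinner_mult_left assms)
  then show ?thesis by simp
qed

lemma cinner_hermitian:
  assumes "ctranspose X = X" shows "cinner u (X *v u) = of_real (inner u (X *v (u :: 'k::rc_field^'n)))"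
  using two_of_real_inner_vec[of u "X *v u"] assms by (simp add: cinner_mult_left)

lemma hermitian_psd_iff:
  "hermitian_psd X \<longleftrightarrow> ctranspose X = X \<and> (\<forall>v. 0 \<le> inner v (X *v (v :: 'k::rc_field^'n)))"
proof -
  have "hermitian_form X v = of_real (inner v (X *v v))" if "ctranspose X = X" for v
    using cinner_hermitian[OF that, of v] by (simp add: hermitian_form_def cinner_def)
  then show ?thesis by (auto simp: hermitian_psd_def)
qed

text \<open>
  Eigenvectors for distinct eigenvalues are orthogonal, hence linearly independent. Finiteness makes
  the maximum in the definition of \<open>sigma1\<close> meaningful.
\<close>

lemma finite_eigenvalues:
  assumes "ctranspose X = (X :: 'k::rc_field^'n^'n)"
  shows "finite {t. \<exists>v. v \<noteq> 0 \<and> X *v v = of_real t *s v}"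
proof -
  let ?E = "{t. \<exists>v. v \<noteq> 0 \<and> X *v v = of_real t *s v}"
  have "\<forall>t\<in>?E. \<exists>v. v \<noteq> 0 \<and> X *v v = t *\<^sub>R v" unfolding of_real_scale by blast
  then obtain f where "\<forall>t\<in>?E. f t \<noteq> 0 \<and> X *v f t = t *\<^sub>R f t"
    using bchoice[of ?E "\<lambda>t v. v \<noteq> 0 \<and> X *v v = t *\<^sub>R v"] by blast
  then have f: "\<And>t. t \<in> ?E \<Longrightarrow> f t \<noteq> 0 \<and> X *v f t = t *\<^sub>R f t" by blast
  have orth: "inner (f s) (f t) = 0" if "s \<in> ?E" "t \<in> ?E" "s \<noteq> t" for s t
    using hermitian_inner[OF assms, of "f s" "f t"] f[OF that(1)] f[OF that(2)] that(3) by simp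
  then have inj: "inj_on f ?E"
    using f by (metis (no_types, lifting) inj_onI inner_eq_zero_iff)
  have "pairwise orthogonal (f ` ?E)"
    using orth by (auto simp: pairwise_def orthogonal_def)
  moreover have "0 \<notin> f ` ?E" using f by (metis (no_types, lifting) imageE)
  ultimately have "finite (f ` ?E)"
    using pairwise_orthogonal_independent independent_imp_finite by blast
  then show ?thesis using inj by (rule finite_imageD)
qed

text \<open>
  The maximum \<open>m\<close> of the Rayleigh quotient is attained on the compact unit sphere. Its maximizer is a
  zero of the nonnegative form of \<open>m I - X\<close>, hence an eigenvector.
\<close>

lemma sigma1_rayleigh:
  assumes X: "ctranspose X = (X :: 'k::rc_field^'n^'n)"
  obtains v where "norm v = 1" "X *v v = of_real (sigma1 X) *s v"
    "\<And>u. inner u (X *v u) \<le> sigma1 X * (norm u)\<^sup>2"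
proof -
  define q where "q u = inner u (X *v u)" for u
  have lin: "linear ((*v) X)" by (rule linear_matrix_vector)
  have "sphere (0::'k^'n) 1 \<noteq> {}"
    by simp
  moreover have "continuous_on (sphere 0 1) q"
    unfolding q_def by (intro continuous_intros linear_continuous_on lin linear_linear[THEN iffD2])
  ultimately obtain v where v: "norm v = 1" "\<And>u. norm u = 1 \<Longrightarrow> q u \<le> q v"
    using continuous_attains_sup[of "sphere 0 1" q] by (auto simp: dist_norm)
  define m where "m = q v"
  have bound: "q u \<le> m * (norm u)\<^sup>2" for u
  proof (cases "u = 0")
    case False
    have "q ((1 / norm u) *\<^sub>R u) \<le> m" unfolding m_def by (rule v(2)) (use False in simp)
    then show ?thesis using False by (simp add: q_def linear_scale[OF lin] field_simps power2_eq_square)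
  qed (simp add: q_def)
  define Y where "Y u = m *\<^sub>R u - X *v u" for u
  have "Y v = 0"
  proof (rule semidefinite_kernel[of Y])
    show "linear Y" unfolding Y_def
      by (intro linear_compose_sub lin linear_scaleR)
    show "inner (Y u) w = inner u (Y w)" for u w
      by (simp add: Y_def inner_diff_left inner_diff_right hermitian_inner[OF X])
    show "0 \<le> inner u (Y u)" for u
      using bound[of u] by (simp add: Y_def inner_diff_right q_def dot_square_norm)
    show "inner v (Y v) = 0"
      using v(1) by (simp add: Y_def inner_diff_right m_def q_def dot_square_norm)
  qed
  then have ev: "X *v v = m *\<^sub>R v" by (simp add: Y_def)
  have "sigma1 X = m" unfolding sigma1_def
  proof (rule Max_eqI[OF finite_eigenvalues[OF X]])
    show "m \<in> {t. \<exists>v. v \<noteq> 0 \<and> X *v v = of_real t *s v}"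
    proof -
      have "v \<noteq> 0" using v(1) by auto
      then show ?thesis using ev unfolding of_real_scale by blast
    qed
    show "t \<le> m" if "t \<in> {t. \<exists>v. v \<noteq> 0 \<and> X *v v = of_real t *s v}" for t
    proof -
      from that obtain u where "u \<noteq> 0" "X *v u = t *\<^sub>R u" unfolding of_real_scale by auto
      then show ?thesis using bound[of u] by (simp add: q_def dot_square_norm)
    qed
  qed
  then show ?thesis using that[of v] v(1) ev bound by (simp add: q_def of_real_scale)
qed

lemma outer_square_mult_vec: "outer_square x *v u = cinner x u *s (x :: 'k::rc_field^'n)"
  by (simp add: vec_eq_iff outer_square_def matrix_vector_mult_def cinner_def sum_distrib_right
      sum_distrib_left algebra_simps)

lemma ctranspose_outer_square: "ctranspose (outer_square x) = outer_square (x :: 'k::rc_field^'n)"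
  by (simp add: vec_eq_iff outer_square_def ctranspose_def conjugate_dist_mul mult.commute)

lemma inner_outer_square: "inner u (outer_square x *v u) = (norm (cinner x (u :: 'k::rc_field^'n)))\<^sup>2"
proof -
  have "of_real (inner u (outer_square x *v u)) = cinner u (outer_square x *v u)"
    by (simp add: cinner_hermitian ctranspose_outer_square)
  also have "\<dots> = of_real ((norm (cinner x u))\<^sup>2)"
    by (simp only: outer_square_mult_vec cinner_scale_right conjugate_cinner[of x u, symmetric]
        mult.commute conjugate_mult_self[symmetric])
  finally show ?thesis by (simp only: of_real_eq_iff)
qed

lemma hermitian_psd_outer_square: "hermitian_psd (outer_square (x :: 'k::rc_field^'n))"
  by (simp add: hermitian_psd_iff ctranspose_outer_square inner_outer_square)

lemma trace_outer_square: "trace (outer_square x) = of_real ((norm (x :: 'k::rc_field^'n))\<^sup>2)"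
  by (simp only: cinner_self[symmetric]) (simp add: trace_def outer_square_def cinner_def mult.commute)

lemma sigma1_outer_square:
  assumes "x \<noteq> 0" shows "(norm (x :: 'k::rc_field^'n))\<^sup>2 \<le> sigma1 (outer_square x)"
proof -
  obtain v where "\<And>u. inner u (outer_square x *v u) \<le> sigma1 (outer_square x) * (norm u)\<^sup>2"
    using sigma1_rayleigh[OF ctranspose_outer_square] by metis
  from this[of x] have "((norm x)\<^sup>2)\<^sup>2 \<le> sigma1 (outer_square x) * (norm x)\<^sup>2"
    by (simp add: inner_outer_square cinner_self norm_power)
  then show ?thesis using assms by (simp add: power2_eq_square)
qed

lemma outer_square_scale:
  "outer_square (c *s x) = of_real ((norm c)\<^sup>2) *\<^sub>R outer_square (x :: 'k::rc_field^'n)"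
proof -
  have "c * x $ i * conjugate (c * x $ j) = of_real ((norm c)\<^sup>2) * (x $ i * conjugate (x $ j))" for i j
    by (simp only: conjugate_mult_self[symmetric] conjugate_dist_mul) (simp add: ac_simps)
  then show ?thesis by (simp add: vec_eq_iff scaleR_entry outer_square_def del: vector_scaleR_component)
qed

text \<open>
  Let \<open>v\<close> be a unit eigenvector for \<open>m = sigma1 X\<close>. Removing the component along \<open>v\<close> leaves
  \<open>Y = X - m v v\<^sup>*\<close> positive semidefinite, with trace \<open>\<tau> - m\<close>. If that trace vanishes, so do all
  diagonal entries of \<open>Y\<close>, hence \<open>Y\<close> itself.
\<close>

lemma psd_sigma1_trace:
  fixes X :: "'k::rc_field^'n^'n"
  assumes X: "hermitian_psd X" and tr: "trace X = of_real \<tau>"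
  shows sigma1_le_trace: "sigma1 X \<le> \<tau>"
    and rank_one_if_trace_le_sigma1: "\<tau> \<le> sigma1 X \<Longrightarrow> \<exists>x. X = outer_square x"
proof -
  define m where "m = sigma1 X"
  have H: "ctranspose X = X" and nonneg: "\<And>u. 0 \<le> inner u (X *v u)"
    using X by (auto simp: hermitian_psd_iff)
  obtain v where v: "norm v = 1" "X *v v = of_real m *s v"
    using sigma1_rayleigh[OF H] unfolding m_def by metis
  have "m \<ge> 0" using nonneg[of v] v by (simp add: of_real_scale dot_square_norm)
  define Y where "Y = X - m *\<^sub>R outer_square v"
  have Yv: "Y *v u = X *v u - (of_real m * cinner v u) *s v" for u
    by (simp only: Y_def matrix_vector_mult_diff_rdistrib scaleR_mult_vec outer_square_mult_vec
        of_real_scale[symmetric] vector_smult_assoc)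
  have YH: "ctranspose Y = Y"
    using H ctranspose_outer_square[of v]
    by (simp add: Y_def ctranspose_def vec_eq_iff conjugate_diff conjugate_dist_mul scaleR_entry
        del: vector_scaleR_component)
  have Ynonneg: "0 \<le> inner u (Y *v u)" for u
  proof -
    define c where "c = cinner v u"
    define w where "w = u - c *s v"
    have u: "u = c *s v + w" by (simp add: w_def)
    have vw: "cinner v w = 0" using v(1) by (simp add: w_def c_def cinner_simps cinner_self)
    then have wv: "cinner w v = 0" using conjugate_cinner[of v w] by simp
    have vXw: "cinner v (X *v w) = 0"
      using vw v(2) by (simp add: cinner_mult_left[of X, unfolded H, symmetric] cinner_simps)
    have Yu: "Y *v u = X *v w"
    proof -
      have "X *v u = c *s (X *v v) + X *v w"
        by (subst u) (simp add: matrix_vector_right_distrib vector_scalar_commute)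
      then show ?thesis
        unfolding Yv c_def[symmetric] v(2) by (simp add: vector_smult_assoc mult.commute)
    qed
    have "of_real (inner u (Y *v u)) = cinner u (X *v w)"
      using cinner_hermitian[OF YH, of u] by (simp add: Yu)
    also have "\<dots> = of_real (inner w (X *v w))"
      by (subst u) (simp add: cinner_simps vXw cinner_hermitian[OF H])
    finally show ?thesis using nonneg[of w] by simp
  qed
  define d where "d i = inner (axis i 1) (Y *v axis i 1)" for i
  have d: "Y $ i $ i = of_real (d i)" for i
    using cinner_hermitian[OF YH, of "axis i 1"] by (simp add: d_def matrix_vector_mult_axis column_def)
  have "trace Y = trace X - of_real m * trace (outer_square v)"
    by (simp add: Y_def trace_def sum_subtractf sum_distrib_left scaleR_entry
        del: vector_scaleR_component)
  then have "(of_real (\<Sum>i\<in>UNIV. d i) :: 'k) = of_real (\<tau> - m)"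
    by (simp add: trace_def[of Y] d tr trace_outer_square v(1))
  then have sum_d: "(\<Sum>i\<in>UNIV. d i) = \<tau> - m" by (simp only: of_real_eq_iff)
  have d_nonneg: "d i \<ge> 0" for i using Ynonneg by (simp add: d_def)
  have "(\<Sum>i\<in>UNIV. d i) \<ge> 0" using d_nonneg by (simp add: sum_nonneg)
  then show "sigma1 X \<le> \<tau>" using sum_d by (simp add: m_def)
  show "\<exists>x. X = outer_square x" if "\<tau> \<le> sigma1 X"
  proof -
    have "(\<Sum>i\<in>UNIV. d i) = 0" using that sum_d \<open>(\<Sum>i\<in>UNIV. d i) \<ge> 0\<close> by (simp add: m_def)
    then have "d i = 0" for i using d_nonneg by (simp add: sum_nonneg_eq_0_iff)
    then have "Y *v axis i 1 = 0" for i
      by (intro semidefinite_kernel[of "(*v) Y"])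
        (auto simp: linear_matrix_vector hermitian_inner[OF YH] Ynonneg d_def)
    then have "Y = 0" by (simp add: matrix_eq_columns[of Y 0])
    then have "X = outer_square (of_real (sqrt m) *s v)"
      using \<open>m \<ge> 0\<close> by (simp add: Y_def outer_square_scale)
    then show ?thesis by blast
  qed
qed

lemma outer_square_mult:
  "A ** outer_square x ** ctranspose A = outer_square (A *v (x :: 'k::rc_field^'n))"
proof -
  have "(A ** outer_square x ** ctranspose A) *v axis j 1 = outer_square (A *v x) *v axis j 1" for j
    by (simp add: matrix_vector_mul_assoc[symmetric] outer_square_mult_vec cinner_mult_left
        vector_scalar_commute)
  then show ?thesis by (simp add: matrix_eq_columns)
qed

lemma lifted_op_outer_square:
  "lifted_op A (outer_square x) = (\<chi> i. of_real ((norm ((A *v (x :: 'k::rc_field^'n)) $ i))\<^sup>2))"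
  by (simp only: vec_eq_iff vec_lambda_beta lifted_op_def outer_square_mult conjugate_mult_self[symmetric])
    (simp add: outer_square_def mult.commute)

text \<open>
  The trace of a feasible matrix is the sum of the prescribed values, since \<open>A\<^sup>* A = I\<close>. So
  \<open>x\<^sub>0 x\<^sub>0\<^sup>*\<close> reaches the upper bound of \<open>sigma1\<close> given by the trace, and other minimizers reach it too.
\<close>

lemma minimizer_iff_if_phase_retrieval:
  fixes A :: "'k::rc_field^'n^'m"
  assumes A: "standardized A" and x0: "x0 \<noteq> 0"
    and retr: "\<And>x. (\<forall>i. norm ((A *v x) $ i) = norm ((A *v x0) $ i)) \<Longrightarrow> \<exists>c. x = c *s x0"
    and X: "feasible A (vec_modulus (A *v x0)) X"
  shows "global_minimizer A (vec_modulus (A *v x0)) X \<longleftrightarrow> X = outer_square x0"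
proof -
  let ?b = "vec_modulus (A *v x0)"
  have tr: "trace Z = of_real ((norm x0)\<^sup>2)" if "feasible A ?b Z" for Z
  proof -
    have "trace Z = trace (ctranspose A ** (A ** Z))"
      using A by (simp add: matrix_mul_assoc standardized_def)
    also have "\<dots> = trace (A ** Z ** ctranspose A)" by (rule trace_mul_sym)
    also have "\<dots> = (\<Sum>i\<in>UNIV. lifted_op A Z $ i)" by (simp add: trace_def lifted_op_def)
    also have "\<dots> = of_real ((norm (A *v x0))\<^sup>2)"
      using that by (simp add: feasible_def vec_modulus_def norm_vec_def L2_set_def sum_nonneg)
    finally show ?thesis by (simp add: standardized_norm[OF A])
  qed
  have feas: "feasible A ?b (outer_square x0)"
    by (simp add: feasible_def hermitian_psd_outer_square lifted_op_outer_square vec_modulus_def)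
  have le: "sigma1 Z \<le> sigma1 (outer_square x0)" if "feasible A ?b Z" for Z
    using sigma1_le_trace[OF _ tr[OF that]] sigma1_outer_square[OF x0] that
    by (simp add: feasible_def)
  show ?thesis
  proof
    assume "X = outer_square x0"
    then show "global_minimizer A ?b X"
      using feas le by (force simp: global_minimizer_def is_arg_min_def)
  next
    assume "global_minimizer A ?b X"
    then have "sigma1 (outer_square x0) \<le> sigma1 X"
      using feas by (auto simp: global_minimizer_def is_arg_min_def not_less)
    then have "(norm x0)\<^sup>2 \<le> sigma1 X" using sigma1_outer_square[OF x0] by linarith
    then obtain x where x: "X = outer_square x"
      using rank_one_if_trace_le_sigma1[OF _ tr[OF X]] X by (auto simp: feasible_def)
    have "(of_real ((norm ((A *v x) $ i))\<^sup>2) :: 'k) = of_real ((norm ((A *v x0) $ i))\<^sup>2)" for i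
      using X by (simp add: feasible_def x lifted_op_outer_square vec_modulus_def vec_eq_iff)
    then have "norm ((A *v x) $ i) = norm ((A *v x0) $ i)" for i
      by (rule of_real_power2_eqD) simp_all
    then obtain c where c: "x = c *s x0" using retr by blast
    have "(of_real ((norm x)\<^sup>2) :: 'k) = of_real ((norm x0)\<^sup>2)"
      using tr[OF X] by (simp add: x trace_outer_square)
    then have "norm x = norm x0" by (rule of_real_power2_eqD) simp_all
    then have "norm c = 1" using x0 by (simp add: c vec_norm_scale)
    then show "X = outer_square x0" by (simp add: x c outer_square_scale)
  qed
qed

section \<open>Gram-Schmidt orthonormalization\<close>

text \<open>
  What is left of \<open>v\<close> after the first \<open>k\<close> steps of the modified Gram-Schmidt process applied to the
  sequence \<open>g\<close>; the \<open>k\<close>-th orthogonalized vector is \<open>residual g k (g k)\<close>. If it vanishes, division by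
  zero makes the corresponding step trivial, so that the recursion needs no case distinction.
\<close>

primrec residual :: "(nat \<Rightarrow> 'k::rc_field^'m) \<Rightarrow> nat \<Rightarrow> 'k^'m \<Rightarrow> 'k^'m" where
  "residual g 0 v = v"
| "residual g (Suc k) v = residual g k v -
     (cinner (residual g k (g k)) (residual g k v) / cinner (residual g k (g k)) (residual g k (g k)))
       *s residual g k (g k)"

lemma residual_unitary:
  assumes "unitary_matrix U"
  shows "residual (\<lambda>k. U *v g k) k (U *v v) = U *v residual g k v"
  using unitary_imp_standardized[OF assms]
  by (induction k arbitrary: v)
    (simp_all add: standardized_cinner matrix_vector_mult_diff_distrib vector_scalar_commute)

lemma cinner_self_eq_0_iff [simp]: "cinner v v = 0 \<longleftrightarrow> v = (0 :: 'k::rc_field^'m)"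
  by (simp add: cinner_self)

lemma residual_orthogonal:
  assumes "l < k" shows "cinner (residual g l (g l)) (residual g k v) = 0"
  using assms
proof (induction k arbitrary: v)
  case (Suc k)
  show ?case
  proof (cases "l = k")
    case True
    then show ?thesis by (cases "residual g k (g k) = 0") (simp_all add: cinner_simps)
  next
    case False
    then show ?thesis using Suc by (simp add: cinner_simps)
  qed
qed simp

lemma residual_span: "v - residual g k v \<in> vec.span (g ` {..<k})"
proof (induction k arbitrary: v)
  case (Suc k)
  let ?u = "residual g k (g k)" and ?S = "vec.span (g ` {..<Suc k})"
  have mono: "vec.span (g ` {..<k}) \<subseteq> ?S" by (rule vec.span_mono) auto
  have "g k \<in> ?S" by (rule vec.span_base) auto
  moreover have "g k - ?u \<in> ?S" using Suc.IH mono by blast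
  ultimately have "g k - (g k - ?u) \<in> ?S" by (rule vec.span_diff)
  then have u: "?u \<in> ?S" by simp
  have "(v - residual g k v) + c *s ?u \<in> ?S" for c
    using Suc.IH[of v] mono u by (intro vec.span_add vec.span_scale) auto
  then show ?case by (simp add: algebra_simps)
qed (simp add: vec.span_zero)

lemma continuous_on_cinner [continuous_intros]:
  fixes f g :: "'a::topological_space \<Rightarrow> 'k::rc_field^'m"
  assumes "continuous_on S f" "continuous_on S g"
  shows "continuous_on S (\<lambda>x. cinner (f x) (g x))"
  unfolding cinner_def by (intro continuous_intros assms)

lemma continuous_on_scale [continuous_intros]:
  fixes f :: "'a::topological_space \<Rightarrow> 'k::rc_field" and g :: "'a \<Rightarrow> 'k^'m"
  assumes "continuous_on S f" "continuous_on S g"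
  shows "continuous_on S (\<lambda>x. f x *s g x)"
  unfolding vector_scalar_mult_def by (intro continuous_intros assms)

lemma continuous_on_matrix_vector_mult [continuous_intros]:
  fixes f :: "'a::topological_space \<Rightarrow> 'k::rc_field^'n^'m" and g :: "'a \<Rightarrow> 'k^'n"
  assumes "continuous_on S f" "continuous_on S g"
  shows "continuous_on S (\<lambda>x. f x *v g x)"
  unfolding matrix_vector_mult_def by (intro continuous_intros assms)

lemma continuous_on_matrix_mult [continuous_intros]:
  fixes f :: "'a::topological_space \<Rightarrow> 'k::rc_field^'n^'m" and g :: "'a \<Rightarrow> 'k^'p^'n"
  assumes "continuous_on S f" "continuous_on S g"
  shows "continuous_on S (\<lambda>x. f x ** g x)"
  unfolding matrix_matrix_mult_def by (intro continuous_intros assms)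

lemma continuous_on_ctranspose [continuous_intros]:
  fixes f :: "'a::topological_space \<Rightarrow> 'k::rc_field^'n^'m"
  assumes "continuous_on S f"
  shows "continuous_on S (\<lambda>x. ctranspose (f x))"
  unfolding ctranspose_def by (intro continuous_intros assms)

lemma borel_measurable_residual:
  fixes g :: "'a \<Rightarrow> nat \<Rightarrow> 'k::rc_field^'m"
  assumes "\<And>k. (\<lambda>x. g x k) \<in> borel_measurable M" "f \<in> borel_measurable M"
  shows "(\<lambda>x. residual (g x) k (f x)) \<in> borel_measurable M"
  using assms(2)
proof (induction k arbitrary: f)
  case (Suc k)
  let ?u = "\<lambda>x. residual (g x) k (g x k)" and ?w = "\<lambda>x. residual (g x) k (f x)"
  have [measurable]: "?u \<in> borel_measurable M" "?w \<in> borel_measurable M"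
    using Suc assms(1) by auto
  have [measurable]: "(\<lambda>x. cinner (h1 x) (h2 x)) \<in> borel_measurable M"
    if "h1 \<in> borel_measurable M" "h2 \<in> borel_measurable M" for h1 h2 :: "'a \<Rightarrow> 'k^'m"
    using that by (rule borel_measurable_continuous_Pair) (intro continuous_intros)
  have [measurable]: "(\<lambda>x. c x *s h x) \<in> borel_measurable M"
    if "c \<in> borel_measurable M" "h \<in> borel_measurable M" for c and h :: "'a \<Rightarrow> 'k^'m"
    using that by (rule borel_measurable_continuous_Pair) (intro continuous_intros)
  show ?case by simp
qed simp

text \<open>
  The matrix with a single column \<open>v\<close>: it serves to assemble matrices from columns, and as the
  direction in which a single column of a matrix is varied.
\<close>

definition column_matrix :: "'n \<Rightarrow> 'k::rc_field^'m \<Rightarrow> 'k^'n^'m" where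
  "column_matrix j v = (\<chi> i l. if l = j then v $ i else 0)"

lemma column_column_matrix: "column l (column_matrix j v) = (if l = j then v else 0)"
  by (simp add: column_def column_matrix_def vec_eq_iff)

lemma column_add: "column j (A + B) = column j A + column j (B :: 'k::rc_field^'n^'m)"
  by (simp add: column_def vec_eq_iff)

lemma linear_column_matrix: "linear (column_matrix j :: 'k::rc_field^'m \<Rightarrow> 'k^'n^'m)"
  by (rule linearI) (simp_all add: column_matrix_def vec_eq_iff)

lemma linear_column: "linear (column j :: 'k::rc_field^'n^'m \<Rightarrow> 'k^'m)"
  by (rule linearI) (simp_all add: column_def vec_eq_iff)

lemma borel_measurable_linear:
  fixes f :: "'a::euclidean_space \<Rightarrow> 'b::euclidean_space"
  shows "linear f \<Longrightarrow> f \<in> borel_measurable borel"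
  by (intro borel_measurable_continuous_onI linear_continuous_on) (simp add: linear_linear)

lemma column_mult: "column j (A ** B) = A *v column j (B :: 'k::rc_field^'n^'m)"
  by (simp add: matrix_vector_mult_axis[symmetric] matrix_vector_mul_assoc)

lemma mult_vec_eq_sum_columns: "A *v c = (\<Sum>j\<in>UNIV. c $ j *s column j (A :: 'k::rc_field^'n^'m))"
  by (simp add: vec_eq_iff matrix_vector_mult_def column_def mult.commute)

text \<open>
  Index types carry no order, so the order in which Gram-Schmidt visits the columns is fixed by a
  ranking \<open>rk\<close> of the indices with inverse \<open>e\<close>.
\<close>

locale column_order =
  fixes rk :: "'m::finite \<Rightarrow> nat" and e :: "nat \<Rightarrow> 'm"
  assumes e_rk [simp]: "e (rk j) = j" and rk_e: "k < CARD('m) \<Longrightarrow> rk (e k) = k"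
    and rk_less: "rk j < CARD('m)"
begin

definition gs_vec :: "'k::rc_field^'m^'m \<Rightarrow> nat \<Rightarrow> 'k^'m" where
  "gs_vec G k = residual (\<lambda>l. column (e l) G) k (column (e k) G)"

definition gram_schmidt :: "'k::rc_field^'m^'m \<Rightarrow> 'k^'m^'m" where
  "gram_schmidt G = (\<Sum>j\<in>UNIV. column_matrix j (inverse (norm (gs_vec G (rk j))) *\<^sub>R gs_vec G (rk j)))"

lemma column_gram_schmidt:
  "column j (gram_schmidt G) = inverse (norm (gs_vec G (rk j))) *\<^sub>R gs_vec G (rk j)"
  unfolding gram_schmidt_def linear_sum[OF linear_column] column_column_matrix by simp

lemma gs_vec_unitary: "unitary_matrix U \<Longrightarrow> gs_vec (U ** G) k = U *v gs_vec G k"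
  by (simp add: gs_vec_def column_mult residual_unitary)

text \<open>
  This equivariance, together with the invariance of Lebesgue null sets under unitary maps, is what
  makes the distribution of \<open>gram_schmidt G\<close> behave like a Haar measure.
\<close>

lemma gram_schmidt_unitary:
  assumes U: "unitary_matrix U" shows "gram_schmidt (U ** G) = U ** gram_schmidt G"
  using standardized_norm[OF unitary_imp_standardized[OF U]]
  by (simp add: matrix_eq_columns matrix_vector_mult_axis column_mult column_gram_schmidt
      gs_vec_unitary[OF U] linear_scale[OF linear_matrix_vector])

lemma borel_measurable_gs_vec [measurable]: "(\<lambda>G. gs_vec G k) \<in> borel_measurable borel"
  unfolding gs_vec_def
  by (intro borel_measurable_residual borel_measurable_linear linear_column)

lemma borel_measurable_gram_schmidt [measurable]: "gram_schmidt \<in> borel_measurable borel"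
  unfolding gram_schmidt_def
  by (intro borel_measurable_sum measurable_compose[OF _ borel_measurable_linear[OF linear_column_matrix]])
    measurable

lemma unitary_gram_schmidt:
  assumes "\<And>j. gs_vec G (rk j) \<noteq> 0" shows "unitary_matrix (gram_schmidt G)"
proof (intro standardized_imp_unitary standardizedI)
  fix i j :: 'm
  have less: "cinner (gs_vec G l) (gs_vec G k) = 0" if "l < k" for l k
    unfolding gs_vec_def
    by (rule residual_orthogonal[OF that, of "\<lambda>l. column (e l) G"])
  have "cinner (gs_vec G (rk i)) (gs_vec G (rk j)) = 0" if "i \<noteq> j"
  proof -
    have "rk i \<noteq> rk j" using that by (metis e_rk)
    then consider "rk i < rk j" | "rk j < rk i" by linarith
    then show ?thesis
    proof cases
      case 2
      then show ?thesis using less[OF 2] conjugate_cinner[of "gs_vec G (rk j)" "gs_vec G (rk i)"] by simp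
    qed (rule less)
  qed
  moreover have "gs_vec G (rk j) \<noteq> 0" by (rule assms)
  ultimately show "cinner (gram_schmidt G *v axis i 1) (gram_schmidt G *v axis j 1) = (if i = j then 1 else 0)"
    unfolding matrix_vector_mult_axis column_gram_schmidt of_real_scale[symmetric] cinner_simps
      conjugate_of_real
    by (simp add: cinner_self power2_eq_square field_simps)
qed

lemma gs_vec_span: "column (e k) G - gs_vec G k \<in> vec.span ((\<lambda>l. column (e l) G) ` {..<k})"
  unfolding gs_vec_def by (rule residual_span)

lemma in_span_columnsD:
  assumes "n \<le> CARD('m)"
  shows "y \<in> vec.span ((\<lambda>l. column (e l) G) ` {..<n}) \<Longrightarrow>
    \<exists>c. (\<forall>j. n \<le> rk j \<longrightarrow> c $ j = 0) \<and> y = G *v (c :: 'k::rc_field^'m)"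
proof -
  let ?R = "{y. \<exists>c. (\<forall>j. n \<le> rk j \<longrightarrow> c $ j = 0) \<and> y = G *v (c :: 'k::rc_field^'m)}"
  have "vec.subspace ?R"
  proof (rule vec.subspaceI)
    show "0 \<in> ?R" by (auto intro!: exI[of _ 0])
    show "x + y \<in> ?R" if "x \<in> ?R" "y \<in> ?R" for x y
    proof -
      from that obtain c d where "\<forall>j. n \<le> rk j \<longrightarrow> c $ j = 0" "x = G *v c"
        "\<forall>j. n \<le> rk j \<longrightarrow> d $ j = 0" "y = G *v d" by blast
      then show ?thesis
        by (intro CollectI exI[of _ "c + d"]) (simp add: matrix_vector_right_distrib)
    qed
    show "a *s x \<in> ?R" if "x \<in> ?R" for a x
    proof -
      from that obtain c where "\<forall>j. n \<le> rk j \<longrightarrow> c $ j = 0" "x = G *v c" by blast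
      then show ?thesis by (intro CollectI exI[of _ "a *s c"]) (simp add: vector_scalar_commute)
    qed
  qed
  moreover have "(\<lambda>l. column (e l) G) ` {..<n} \<subseteq> ?R"
  proof safe
    fix l assume "l < n"
    then show "\<exists>c. (\<forall>j. n \<le> rk j \<longrightarrow> c $ j = 0) \<and> column (e l) G = G *v c"
      using assms rk_e[of l]
      by (intro exI[of _ "axis (e l) 1"] conjI)
        (auto simp: axis_def, simp add: matrix_vector_mult_axis flip: axis_def)
  qed
  ultimately have "vec.span ((\<lambda>l. column (e l) G) ` {..<n}) \<subseteq> ?R" by (rule vec.span_minimal[rotated])
  then show "y \<in> vec.span ((\<lambda>l. column (e l) G) ` {..<n}) \<Longrightarrow>
    \<exists>c. (\<forall>j. n \<le> rk j \<longrightarrow> c $ j = 0) \<and> y = G *v c" by blast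
qed

text \<open>
  The span of the first \<open>n\<close> columns does not grow under Gram-Schmidt: vectors in the range of the
  orthonormalized frame are expressed through the columns of \<open>G\<close>, whose distribution is explicit.
\<close>

lemma gram_schmidt_mult_vec:
  assumes "n \<le> CARD('m)" "\<And>j. n \<le> rk j \<Longrightarrow> x $ j = 0"
  obtains c where "\<And>j. n \<le> rk j \<Longrightarrow> c $ j = 0" "gram_schmidt G *v x = G *v c"
proof -
  let ?S = "vec.span ((\<lambda>l. column (e l) G) ` {..<n})"
  have "x $ j *s column j (gram_schmidt G) \<in> ?S" for j
  proof (cases "rk j < n")
    case True
    let ?T = "vec.span ((\<lambda>l. column (e l) G) ` {..<rk j})"
    have sub: "?T \<subseteq> ?S" using True by (intro vec.span_mono image_mono) auto
    have "column j G \<in> ?S" using True by (intro vec.span_base) (force intro: image_eqI[of _ _ "rk j"])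
    moreover have "column j G - gs_vec G (rk j) \<in> ?S" using gs_vec_span[of "rk j" G] sub by auto
    ultimately have "column j G - (column j G - gs_vec G (rk j)) \<in> ?S" by (rule vec.span_diff)
    then show ?thesis
      by (simp add: column_gram_schmidt vec.span_scale flip: of_real_scale)
  next
    case False
    then show ?thesis using assms(2) by (simp add: vec.span_zero)
  qed
  then have "gram_schmidt G *v x \<in> ?S"
    by (simp add: mult_vec_eq_sum_columns[of "gram_schmidt G"] vec.span_sum)
  from in_span_columnsD[OF assms(1) this] show ?thesis using that by blast
qed

end

section \<open>Null sets of the Haar measure\<close>

lemma null_sets_lborel_if_negligible:
  "S \<in> sets borel \<Longrightarrow> negligible S \<Longrightarrow> S \<in> null_sets (lborel :: 'a::euclidean_space measure)"
  by (simp add: negligible_iff_null_sets null_sets_completion_iff)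

lemma AE_lborel_exists:
  assumes "AE x in (lborel :: 'a::euclidean_space measure). P x"
  shows "\<exists>x. P x"
proof (rule ccontr)
  assume "\<nexists>x. P x"
  then have "AE x in (lborel :: 'a measure). False" using assms by simp
  then have "emeasure (lborel :: 'a measure) (space lborel) = 0"
    by (simp add: AE_iff_null null_sets_def)
  then show False by simp
qed

text \<open>
  By Fubini the set of all \<open>(M, v)\<close> with \<open>M + \<iota> v \<in> B\<close> is null, so the translate \<open>B - \<iota> v\<close> is null for
  some \<open>v\<close>. Averaging over translations avoids splitting the measure on the large space into a
  product.
\<close>

lemma null_sets_if_slices_negligible:
  fixes \<iota> :: "'b::euclidean_space \<Rightarrow> 'a::euclidean_space"
  assumes \<iota>: "linear \<iota>" and B: "B \<in> sets borel"
    and slice: "\<And>M. negligible {v. M + \<iota> v \<in> B}"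
  shows "B \<in> null_sets lborel"
proof -
  have [measurable]: "\<iota> \<in> borel_measurable borel" using \<iota> by (rule borel_measurable_linear)
  note B[measurable]
  have "AE v in lborel. M + \<iota> v \<notin> B" for M
  proof -
    have "{v. M + \<iota> v \<in> B} \<in> null_sets lborel"
      by (rule null_sets_lborel_if_negligible[OF _ slice]) measurable
    then show ?thesis by (rule AE_not_in[THEN AE_mp]) simp
  qed
  then have "AE M in lborel. AE v in lborel. M + \<iota> v \<notin> B" by simp
  then have "AE v in lborel. AE M in lborel. M + \<iota> v \<notin> B"
    by (subst (asm) lborel_pair.AE_commute) measurable
  then obtain v where "AE M in lborel. M + \<iota> v \<notin> B" using AE_lborel_exists by blast
  then have "AE M in distr lborel borel ((+) (\<iota> v)). M \<notin> B"
    by (subst AE_distr_iff) (auto simp: add.commute)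
  then have "AE M in lborel. M \<notin> B" by (simp only: lborel_distr_plus)
  then show ?thesis using B by (subst (asm) AE_iff_null) auto
qed

lemma AE_lborel_unitary_mult:
  fixes P :: "'k::rc_field^'p^'m \<Rightarrow> bool"
  assumes P: "AE G in lborel. P G" and U: "unitary_matrix U"
  shows "AE G in lborel. P (U ** G)"
proof -
  obtain N where N': "\<And>G. G \<in> space lborel - N \<Longrightarrow> P G" and null: "N \<in> null_sets lborel"
    by (rule AE_E3[OF P]) (rule that)
  have N: "{G. \<not> P G} \<subseteq> N" "N \<in> null_sets lborel" using N' null by auto
  have lin: "linear ((**) (V :: 'k^'m^'m) :: 'k^'p^'m \<Rightarrow> 'k^'p^'m)" for V
    by (rule linearI) (simp_all add: vec_eq_iff matrix_matrix_mult_def scaleR_sum_right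
        distrib_left sum.distrib)
  have "{G. U ** G \<in> N} = (**) (ctranspose U) ` N"
  proof safe
    fix G assume "U ** G \<in> N"
    moreover have "G = ctranspose U ** (U ** G)"
      using U by (simp add: matrix_mul_assoc unitary_matrix_def)
    ultimately show "G \<in> (**) (ctranspose U) ` N" by blast
  next
    fix G assume "G \<in> N"
    then show "U ** (ctranspose U ** G) \<in> N"
      using U by (simp add: matrix_mul_assoc unitary_matrix_def)
  qed
  moreover have "negligible N"
    using N(2) by (simp add: negligible_iff_null_sets null_sets_completionI)
  ultimately have "negligible {G. U ** G \<in> N}"
    using negligible_differentiable_image_negligible[OF order_refl _ linear_imp_differentiable_on[OF lin]]
    by simp
  moreover have "{G. U ** G \<in> N} \<in> sets borel"
    using measurable_sets_borel[OF borel_measurable_linear[OF lin[of U]], of N] null_setsD2[OF N(2)] by (simp add: vimage_def)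
  ultimately have "{G. U ** G \<in> N} \<in> null_sets lborel" by (intro null_sets_lborel_if_negligible)
  then show ?thesis using N(1) by (intro AE_I[of _ _ "{G. U ** G \<in> N}"]) auto
qed

text \<open>
  Projections of compact sets are compact, and closed sets are countable unions of compact ones.
  Sets given by an existential quantifier over a closed condition become measurable in this way.
\<close>

lemma borel_fst_image_closed:
  fixes C :: "('a::euclidean_space \<times> 'b::euclidean_space) set"
  assumes "closed C" shows "fst ` C \<in> sets borel"
proof -
  have "C = (\<Union>n. C \<inter> cball 0 (real n))"
    by (auto intro: real_arch_simple)
  then have "fst ` C = (\<Union>n. fst ` (C \<inter> cball 0 (real n)))" by blast
  moreover have "closed (fst ` (C \<inter> cball 0 (real n)))" for n
    by (intro compact_imp_closed compact_continuous_image continuous_intros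
        closed_Int_compact[OF assms compact_cball])
  ultimately show ?thesis by simp
qed

context column_order
begin

lemma negligible_span:
  fixes g :: "nat \<Rightarrow> 'k::rc_field^'m"
  assumes "k < CARD('m)" shows "negligible (vec.span (g ` {..<k}))"
proof -
  define f where "f c = (\<Sum>l<k. c $ e l *s g l)" for c :: "'k^'m"
  have "linear f" unfolding f_def
    by (rule linearI) (simp_all add: vec_eq_iff sum.distrib scaleR_sum_right distrib_right)
  moreover have "\<not> inj f"
  proof
    assume "inj f"
    have "f (axis (e k) 1) = f 0"
      unfolding f_def
    proof (rule sum.cong[OF refl])
      fix l assume "l \<in> {..<k}"
      then have "e l \<noteq> e k" using assms rk_e[of l] rk_e[of k] by auto
      then show "axis (e k) 1 $ e l *s g l = 0 $ e l *s g l" by (simp add: axis_def)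
    qed
    with \<open>inj f\<close> have "axis (e k) (1::'k) = 0" by (rule injD)
    then show False by (simp add: axis_eq_0_iff)
  qed
  ultimately have "negligible (range f)" by (rule negligible_linear_singular_image)
  moreover have "vec.span (g ` {..<k}) \<subseteq> range f"
  proof (rule vec.span_minimal)
    show "g ` {..<k} \<subseteq> range f"
    proof safe
      fix l assume "l < k"
      have "f (axis (e l) 1) = (\<Sum>l'<k. if l' = l then g l else 0)"
        unfolding f_def
      proof (rule sum.cong[OF refl])
        fix l' assume "l' \<in> {..<k}"
        then have "e l' = e l \<longleftrightarrow> l' = l" using assms \<open>l < k\<close> rk_e[of l] rk_e[of l'] by auto
        then show "axis (e l) 1 $ e l' *s g l' = (if l' = l then g l else 0)" by (simp add: axis_def)
      qed
      then show "g l \<in> range f" using \<open>l < k\<close> by (intro range_eqI[of _ _ "axis (e l) 1"]) simp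
    qed
    show "vec.subspace (range f)"
    proof (rule vec.subspaceI)
      show "0 \<in> range f" by (rule range_eqI[of _ _ 0]) (simp add: f_def)
      show "x + y \<in> range f" if "x \<in> range f" "y \<in> range f" for x y
      proof -
        from that obtain c d where "x = f c" "y = f d" by blast
        then have "x + y = f (c + d)" using linear_add[OF \<open>linear f\<close>] by simp
        then show ?thesis by blast
      qed
      show "a *s x \<in> range f" if "x \<in> range f" for a x
      proof -
        from that obtain c where "x = f c" by blast
        then have "a *s x = f (a *s c)" by (simp add: f_def vec.scale_sum_right vector_smult_assoc)
        then show ?thesis by blast
      qed
    qed
  qed
  ultimately show ?thesis by (rule negligible_subset)
qed

text \<open>
  When only column \<open>j\<close> varies, its Gram-Schmidt vector vanishes only on the proper subspace spanned
  by the columns of smaller rank.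
\<close>

lemma AE_gs_vec_nonzero:
  "AE G in lborel. gs_vec (G :: 'k::rc_field^'m^'m) (rk j) \<noteq> 0"
proof -
  let ?B = "{G :: 'k^'m^'m. gs_vec G (rk j) = 0}"
  have "?B \<in> null_sets lborel"
  proof (rule null_sets_if_slices_negligible[OF linear_column_matrix[of j]])
    show "?B \<in> sets borel" by measurable
    fix M :: "'k^'m^'m"
    let ?W = "vec.span ((\<lambda>l. column (e l) M) ` {..<rk j})"
    have "{v. M + column_matrix j v \<in> ?B} \<subseteq> (+) (- column j M) ` ?W"
    proof safe
      fix v assume "gs_vec (M + column_matrix j v) (rk j) = 0"
      moreover have "column (e l) (M + column_matrix j v) = column (e l) M" if "l < rk j" for l
      proof -
        have "e l \<noteq> j" using that rk_e[of l] rk_less[of j] by auto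
        then show ?thesis by (simp add: column_add column_column_matrix)
      qed
      ultimately have "column j M + v \<in> ?W"
        using gs_vec_span[of "rk j" "M + column_matrix j v"]
        by (simp add: column_add column_column_matrix cong: image_cong_simp)
      then show "v \<in> (+) (- column j M) ` ?W" by (intro image_eqI[of _ _ "column j M + v"]) auto
    qed
    moreover have "negligible ((+) (- column j M) ` ?W)"
      by (intro negligible_translation negligible_span rk_less)
    ultimately show "negligible {v. M + column_matrix j v \<in> ?B}" by (rule negligible_subset[rotated])
  qed
  then show ?thesis by (rule AE_not_in[THEN AE_mp]) simp
qed

lemma AE_unitary_gram_schmidt:
  "AE G in lborel. unitary_matrix (gram_schmidt (G :: 'k::rc_field^'m^'m))"
proof -
  have "AE G in lborel. \<forall>j\<in>UNIV. gs_vec (G :: 'k^'m^'m) (rk j) \<noteq> 0"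
    by (rule AE_finite_allI[OF finite AE_gs_vec_nonzero])
  then show ?thesis by (rule AE_mp) (intro AE_I2 impI unitary_gram_schmidt, blast)
qed

text \<open>
  Write \<open>Q\<close> for Gram-Schmidt. By equivariance, \<open>Q(G)\<^sup>* Q(G') A\<^sub>0 \<notin> Z\<close> for almost all \<open>G'\<close>, whenever
  \<open>Q(G)\<close> is unitary. Exchanging the quantifiers yields one frame \<open>A\<^sub>1 = Q(G') A\<^sub>0\<close> with \<open>Q(G)\<^sup>* A\<^sub>1 \<notin> Z\<close> for almost all
  \<open>G\<close>. Any standardized \<open>A\<close> satisfies \<open>V A = A\<^sub>1\<close> for a unitary \<open>V\<close>, and \<open>Q(G)\<^sup>* V = Q(V\<^sup>* G)\<^sup>*\<close>
  carries the property over to \<open>A\<close>. Exchanging the quantifiers again, now between \<open>\<mu>\<close> and Lebesgue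
  measure, gives one unitary \<open>Q(G)\<^sup>*\<close> that maps \<open>\<mu>\<close>-almost every \<open>A\<close> outside \<open>Z\<close>; as \<open>\<mu>\<close> is
  invariant, \<open>Z\<close> is null.
\<close>

lemma AE_stiefel_haar_if_AE_gram_schmidt:
  fixes \<mu> :: "('k::rc_field^'n^'m) measure"
  assumes haar: "stiefel_haar \<mu>" and A0: "standardized A0" and Z: "Z \<in> sets borel"
    and gs: "AE G in lborel. gram_schmidt G ** A0 \<notin> Z"
  shows "AE A in \<mu>. A \<notin> Z"
proof -
  note Z[measurable]
  let ?Q = "gram_schmidt :: 'k^'m^'m \<Rightarrow> 'k^'m^'m"
  have mult_meas[measurable (raw)]: "(\<lambda>x. f x ** g x) \<in> borel_measurable M"
    if "f \<in> borel_measurable M" "g \<in> borel_measurable M"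
    for M :: "'z measure" and f :: "'z \<Rightarrow> 'k^'m^'m" and g :: "'z \<Rightarrow> 'k^'n^'m"
    using that by (rule borel_measurable_continuous_Pair) (intro continuous_intros)
  have ct_meas[measurable]: "(ctranspose :: 'k^'m^'m \<Rightarrow> 'k^'m^'m) \<in> borel_measurable borel"
    by (intro borel_measurable_continuous_onI continuous_intros)
  have good: "AE G in lborel. unitary_matrix (?Q G)" by (rule AE_unitary_gram_schmidt)
  have inverse_gs: "AE G in lborel. ctranspose (?Q G) ** A \<notin> Z" if A: "standardized A" for A
  proof -
    have inner: "AE G' in lborel. ctranspose (?Q G) ** (?Q G' ** A0) \<notin> Z"
      if "unitary_matrix (?Q G)" for G
    proof -
      from that have U: "unitary_matrix (ctranspose (?Q G))" by (rule unitary_ctranspose)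
      from AE_lborel_unitary_mult[OF gs U]
      show "AE G' in lborel. ctranspose (?Q G) ** (?Q G' ** A0) \<notin> Z"
        by (simp add: gram_schmidt_unitary[OF U] matrix_mul_assoc)
    qed
    from good have "AE G in lborel. AE G' in lborel. ctranspose (?Q G) ** (?Q G' ** A0) \<notin> Z"
      by (rule AE_mp) (intro AE_I2 impI inner)
    then have "AE G' in lborel. AE G in lborel. ctranspose (?Q G) ** (?Q G' ** A0) \<notin> Z"
      by (subst (asm) lborel_pair.AE_commute) measurable
    with good have "AE G' in lborel. unitary_matrix (?Q G') \<and>
        (AE G in lborel. ctranspose (?Q G) ** (?Q G' ** A0) \<notin> Z)" by (rule AE_conjI)
    then obtain G' where G': "unitary_matrix (?Q G')"
      "AE G in lborel. ctranspose (?Q G) ** (?Q G' ** A0) \<notin> Z" using AE_lborel_exists by blast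
    have "standardized (?Q G' ** A0)"
      using G'(1) A0 by (intro standardized_mult unitary_imp_standardized)
    then obtain V where V: "unitary_matrix V" "V ** A = ?Q G' ** A0"
      using standardized_transitive[OF A] by blast
    have "ctranspose (?Q G) ** (?Q G' ** A0) = ctranspose (?Q (ctranspose V ** G)) ** A" for G
      unfolding V(2)[symmetric] gram_schmidt_unitary[OF unitary_ctranspose[OF V(1)]] ctranspose_mult
      by (simp add: matrix_mul_assoc)
    with G'(2) have "AE G in lborel. ctranspose (?Q (ctranspose V ** G)) ** A \<notin> Z" by simp
    from AE_lborel_unitary_mult[OF this V(1)] show ?thesis
      using V(1) by (simp add: matrix_mul_assoc unitary_matrix_def)
  qed
  have sets: "sets \<mu> = sets (restrict_space borel {A. standardized A})" and "prob_space \<mu>"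
    and inv: "\<And>U. unitary_matrix U \<Longrightarrow> distr \<mu> \<mu> (\<lambda>A. U ** A) = \<mu>"
    using haar by (auto simp: stiefel_haar_def)
  interpret \<mu>: prob_space \<mu> by fact
  interpret pair_sigma_finite \<mu> "lborel :: ('k^'m^'m) measure" ..
  have space: "space \<mu> = {A. standardized A}"
    using sets_eq_imp_space_eq[OF sets] by (simp add: space_restrict_space)
  have id_meas[measurable]: "(\<lambda>A. A) \<in> borel_measurable \<mu>"
    unfolding measurable_cong_sets[OF sets refl] by (intro measurable_restrict_space1) simp
  have "AE A in \<mu>. AE G in lborel. ctranspose (?Q G) ** A \<notin> Z"
  proof (rule AE_I2)
    show "AE G in lborel. ctranspose (?Q G) ** A \<notin> Z" if "A \<in> space \<mu>" for A
      using that by (intro inverse_gs) (simp add: space)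
  qed
  then have "AE G in lborel. AE A in \<mu>. ctranspose (?Q G) ** A \<notin> Z"
    by (subst (asm) AE_commute) measurable
  with good have "AE G in lborel. unitary_matrix (?Q G) \<and> (AE A in \<mu>. ctranspose (?Q G) ** A \<notin> Z)"
    by (rule AE_conjI)
  then obtain G where "unitary_matrix (?Q G)" and G: "AE A in \<mu>. ctranspose (?Q G) ** A \<notin> Z"
    using AE_lborel_exists by blast
  then have U: "unitary_matrix (ctranspose (?Q G))" by (simp add: unitary_ctranspose)
  have mult: "(\<lambda>A. ctranspose (?Q G) ** A) \<in> measurable \<mu> \<mu>"
    unfolding measurable_cong_sets[OF refl sets]
    by (rule measurable_restrict_space2)
      (auto simp: space standardized_mult unitary_imp_standardized[OF U])
  have "{A \<in> space \<mu>. A \<notin> Z} \<in> sets \<mu>" by measurable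
  then have "AE A in distr \<mu> \<mu> (\<lambda>A. ctranspose (?Q G) ** A). A \<notin> Z"
    using G by (subst AE_distr_iff[OF mult])
  then show ?thesis by (simp only: inv[OF U])
qed

end

section \<open>Phase retrieval for a fixed vector\<close>

definition phase_ambiguous :: "'k::rc_field^'n \<Rightarrow> ('k^'n^'m) set" where
  "phase_ambiguous x0 = {A. \<exists>x. (\<nexists>c. x = c *s x0) \<and> (\<forall>i. norm ((A *v x) $ i) = norm ((A *v x0) $ i))}"

text \<open>
  The open condition that \<open>x\<close> is no multiple of \<open>x0\<close> is exhausted by the closed conditions that the
  part of \<open>x\<close> orthogonal to \<open>x0\<close> has norm at least \<open>1 / (p + 1)\<close>.
\<close>

lemma borel_phase_ambiguous:
  fixes x0 :: "'k::rc_field^'n"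
  shows "(phase_ambiguous x0 :: ('k^'n^'m) set) \<in> sets borel"
proof -
  let ?p = "\<lambda>x. x - (cinner x0 x / cinner x0 x0) *s x0"
  define C :: "nat \<Rightarrow> (('k^'n^'m) \<times> ('k^'n)) set" where
    "C p = {z. inverse (real (Suc p)) \<le> norm (?p (snd z))
      \<and> (\<forall>i. norm ((fst z *v snd z) $ i) = norm ((fst z *v x0) $ i))}" for p
  have multiple: "(\<exists>c. x = c *s x0) \<longleftrightarrow> ?p x = 0" for x
    by (cases "x0 = 0") (auto simp: cinner_simps)
  have "(phase_ambiguous x0 :: ('k^'n^'m) set) = (\<Union>p. fst ` C p)"
  proof safe
    fix A :: "'k^'n^'m" assume "A \<in> phase_ambiguous x0"
    then obtain x where "?p x \<noteq> 0" "\<forall>i. norm ((A *v x) $ i) = norm ((A *v x0) $ i)"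
      unfolding phase_ambiguous_def multiple by blast
    moreover from this obtain p where "inverse (real (Suc p)) < norm (?p x)"
      using reals_Archimedean[of "norm (?p x)"] by auto
    ultimately have "(A, x) \<in> C p" by (simp add: C_def)
    then show "A \<in> (\<Union>p. fst ` C p)" by force
  next
    fix p A x assume "(A, x) \<in> C p"
    then have "inverse (real (Suc p)) \<le> norm (?p x)"
      "\<forall>i. norm ((A *v x) $ i) = norm ((A *v x0) $ i)" by (auto simp: C_def)
    moreover from this(1) have "?p x \<noteq> 0" by (auto simp: field_simps)
    ultimately show "fst (A, x) \<in> phase_ambiguous x0"
      unfolding phase_ambiguous_def multiple by auto
  qed
  moreover have "closed (C p)" for p
    unfolding C_def divide_inverse by (intro closed_Collect_conj closed_Collect_all closed_Collect_le closed_Collect_eq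
        continuous_intros)
  ultimately show ?thesis by (auto intro!: sets.countable_UN borel_fst_image_closed)
qed

lemma norm_axis_one: "norm (axis i 1 :: 'k::rc_field^'n) = 1"
proof (rule of_real_power2_eqD)
  show "of_real ((norm (axis i 1 :: 'k^'n))\<^sup>2) = (of_real (1\<^sup>2) :: 'k)"
    unfolding cinner_self[symmetric] cinner_axis by (simp add: axis_def)
qed simp_all

text \<open>
  Linear combinations of the vectors \<open>w l\<close> in which the entries of the distinguished vector \<open>w j\<close> may
  first be multiplied by arbitrary unimodular scalars.
\<close>

definition modulated_combinations :: "('n::finite \<Rightarrow> 'k::rc_field^'m) \<Rightarrow> 'n \<Rightarrow> ('k^'m) set" where
  "modulated_combinations w j =
     {(\<Sum>l\<in>UNIV - {j}. c $ l *s w l) + c $ j *s (\<chi> i. D i * w j $ i) | (c :: 'k^'n) D. \<forall>i. norm (D i) = 1}"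

text \<open>Real unimodular scalars are signs: there are finitely many choices, encoded by a set \<open>S\<close>.\<close>

lemma negligible_modulated_combinations_real:
  fixes w :: "'n::finite \<Rightarrow> real^'m"
  assumes "CARD('n) < CARD('m)"
  shows "negligible (modulated_combinations w j)"
proof -
  define f where "f S c = (\<Sum>l\<in>UNIV - {j}. c $ l *s w l) + c $ j *s (\<chi> i. (if i \<in> S then 1 else -1) * w j $ i)"
    for S and c :: "real^'n"
  have "linear (f S)" for S unfolding f_def
    by (rule linearI) (simp_all add: vec_eq_iff sum.distrib sum_distrib_left algebra_simps)
  then have "negligible (range (f S))" for S
    by (intro negligible_differentiable_image_lowdim linear_imp_differentiable_on) (use assms in simp_all)
  then have "negligible (\<Union>S. range (f S))" by (intro negligible_Union) auto
  moreover have "modulated_combinations w j \<subseteq> (\<Union>S. range (f S))"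
  proof
    fix v assume "v \<in> modulated_combinations w j"
    then obtain c :: "real^'n" and D where D: "\<forall>i. norm (D i) = 1"
      and v: "v = (\<Sum>l\<in>UNIV - {j}. c $ l *s w l) + c $ j *s (\<chi> i. D i * w j $ i)"
      by (auto simp: modulated_combinations_def)
    define S where "S = {i. D i = 1}"
    have "D i = (if i \<in> S then 1 else -1)" for i
      using D[rule_format, of i] by (auto simp: S_def abs_if split: if_splits)
    then have "D = (\<lambda>i. if i \<in> S then 1 else -1)" by (rule ext)
    then have "v = f S c" unfolding v f_def by simp
    then show "v \<in> (\<Union>S. range (f S))" by blast
  qed
  ultimately show ?thesis by (rule negligible_subset)
qed

text \<open>
  Complex unimodular scalars are \<open>cis \<theta>\<close>: the set is a smooth image of the space of angles and
  coefficients, whose real dimension is \<open>N + 2n < 2N\<close>.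
\<close>

lemma negligible_modulated_combinations_complex:
  fixes w :: "'n::finite \<Rightarrow> complex^'m"
  assumes "2 * CARD('n) < CARD('m)"
  shows "negligible (modulated_combinations w j)"
proof -
  define f :: "(real^'m) \<times> (complex^'n) \<Rightarrow> complex^'m" where
    "f p = (\<Sum>l\<in>UNIV - {j}. (snd p $ l) *s w l) + (\<Sum>i\<in>UNIV. axis i (snd p $ j * cis (fst p $ i) * w j $ i))" for p
  have scale: "bounded_linear (\<lambda>c. c *s v)" for v :: "complex^'m"
    by (intro linear_conv_bounded_linear[THEN iffD1] linearI) (simp_all add: vec_eq_iff algebra_simps)
  have ax: "bounded_linear (axis i :: complex \<Rightarrow> complex^'m)" for i
    by (intro linear_conv_bounded_linear[THEN iffD1] linearI) (simp_all add: vec_eq_iff axis_def)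
  have nth: "bounded_linear (\<lambda>p :: (real^'m) \<times> (complex^'n). snd p $ l)" for l
    by (intro bounded_linear_compose[OF bounded_linear_vec_nth] bounded_linear_snd)
  have nth': "bounded_linear (\<lambda>p :: (real^'m) \<times> (complex^'n). \<i> * complex_of_real (fst p $ i))" for i
    by (intro bounded_linear_compose[OF bounded_linear_mult_right]
        bounded_linear_compose[OF bounded_linear_of_real]
        bounded_linear_compose[OF bounded_linear_vec_nth] bounded_linear_fst)
  have exp: "(exp :: complex \<Rightarrow> complex) differentiable (at z)" for z
    using DERIV_exp[of z] unfolding has_field_derivative_def differentiable_def by blast
  have "f differentiable (at p)" for p
    unfolding f_def cis_conv_exp
    by (intro differentiable_add differentiable_sum ballI differentiable_mult differentiable_const
        differentiable_compose[OF exp] bounded_linear_imp_differentiable nth nth' finite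
        differentiable_compose[OF bounded_linear_imp_differentiable[OF scale]]
        differentiable_compose[OF bounded_linear_imp_differentiable[OF ax]])
  then have "negligible (range f)"
    using assms by (intro negligible_differentiable_image_lowdim)
      (simp_all add: differentiable_at_imp_differentiable_on)
  moreover have "modulated_combinations w j \<subseteq> range f"
  proof
    fix v assume "v \<in> modulated_combinations w j"
    then obtain c :: "complex^'n" and D where D: "\<forall>i. norm (D i) = 1"
      and v: "v = (\<Sum>l\<in>UNIV - {j}. c $ l *s w l) + c $ j *s (\<chi> i. D i * w j $ i)"
      by (auto simp: modulated_combinations_def)
    have "D i = cis (Arg (D i))" for i
      using D by (metis cis_Arg norm_zero sgn_eq zero_neq_one div_by_1 of_real_1)
    then have "v = f (\<chi> i. Arg (D i), c)" unfolding v f_def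
      by (simp add: vec_eq_iff axis_def mult.assoc)
    then show "v \<in> range f" by blast
  qed
  ultimately show ?thesis by (rule negligible_subset)
qed

context column_order
begin

text \<open>
  The fixed frame \<open>A\<^sub>0 = E R\<close> embeds \<open>R\<close>, a unitary matrix rotating \<open>x0\<close> into a coordinate axis, into
  the coordinates that Gram-Schmidt visits first, that axis being the very first. Then the range of
  \<open>gram_schmidt G ** A\<^sub>0\<close> is spanned by \<open>n\<close> columns of \<open>G\<close>, and the image of \<open>x0\<close> is parallel to the
  first of them. An ambiguity therefore puts one of the other columns, given the rest, into a set of
  \<open>modulated_combinations\<close>.
\<close>

lemma AE_not_phase_ambiguous:
  fixes x0 :: "'k::rc_field^'n" and \<mu> :: "('k^'n^'m) measure"
  assumes x0: "x0 \<noteq> 0" and le: "CARD('n) \<le> CARD('m)" and haar: "stiefel_haar \<mu>"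
    and negl: "\<And>(w :: 'n \<Rightarrow> 'k^'m) j. negligible (modulated_combinations w j)"
  shows "AE A in \<mu>. A \<notin> phase_ambiguous x0"
proof -
  obtain f where f: "bij_betw f (UNIV :: 'n set) {..<CARD('n)}"
    using ex_bij_betw_finite_nat[of "UNIV :: 'n set"] by (auto simp: lessThan_atLeast0)
  define \<iota> :: "'n \<Rightarrow> 'm" where "\<iota> l = e (f l)" for l
  have f_less: "f l < CARD('n)" for l using f by (auto simp: bij_betw_def)
  have rk_\<iota>: "rk (\<iota> l) = f l" for l
    unfolding \<iota>_def by (rule rk_e[OF less_le_trans[OF f_less le]])
  have inj_\<iota>: "\<iota> l = \<iota> l' \<longleftrightarrow> l = l'" for l l'
    using f rk_\<iota> by (metis bij_betw_imp_inj_on injD)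
  have range_\<iota>: "j \<in> range \<iota>" if "rk j < CARD('n)" for j
  proof -
    from that obtain l where "rk j = f l" using f by (auto simp: bij_betw_def image_iff dest!: equalityD2)
    then have "j = \<iota> l" by (metis \<iota>_def e_rk)
    then show ?thesis by blast
  qed
  have "0 \<in> {..<CARD('n)}" by simp
  then obtain i0 where i0: "f i0 = 0" using f by (metis bij_betw_inv_into_right)

  have e0: "e 0 = \<iota> i0" by (simp add: \<iota>_def i0)

  \<comment> \<open>\<open>c $ j\<close> is bounded away from \<open>0\<close>, not merely nonzero, to make the condition on \<open>(G, c)\<close> closed.\<close>
  have B_null: "{G :: 'k^'m^'m. \<exists>c. inverse (real (Suc p)) \<le> norm (c $ j)
      \<and> (\<forall>i. norm ((\<Sum>l\<in>UNIV. c $ l *s column (\<iota> l) G) $ i) = norm (column (\<iota> i0) G $ i))} \<in> null_sets lborel"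
    (is "?B \<in> _") if "j \<noteq> i0" for j :: 'n and p
  proof (rule null_sets_if_slices_negligible[OF linear_column_matrix[of "\<iota> j"]])
    let ?C = "{z :: ('k^'m^'m) \<times> ('k^'n). inverse (real (Suc p)) \<le> norm (snd z $ j)
      \<and> (\<forall>i. norm ((\<Sum>l\<in>UNIV. snd z $ l *s column (\<iota> l) (fst z)) $ i) = norm (column (\<iota> i0) (fst z) $ i))}"
    have "closed ?C"
      unfolding column_def by (intro closed_Collect_conj closed_Collect_all closed_Collect_le closed_Collect_eq
          continuous_intros)
    moreover have "?B = fst ` ?C"
      unfolding image_iff set_eq_iff mem_Collect_eq Bex_def split_paired_Ex fst_conv snd_conv by blast
    ultimately show "?B \<in> sets borel" using borel_fst_image_closed by simp
    fix M :: "'k^'m^'m"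
    \<comment> \<open>Slot \<open>j\<close> of the combination is free, as column \<open>j\<close> is solved for; it holds the modulated first column.\<close>
    let ?w = "\<lambda>l. column (\<iota> (if l = j then i0 else l)) M"
    have "{v. M + column_matrix (\<iota> j) v \<in> ?B} \<subseteq> (+) (- column (\<iota> j) M) ` modulated_combinations ?w j"
    proof safe
      fix v c
      let ?G = "M + column_matrix (\<iota> j) v"
      assume c: "inverse (real (Suc p)) \<le> norm (c $ j)"
        and eq: "\<forall>i. norm ((\<Sum>l\<in>UNIV. c $ l *s column (\<iota> l) ?G) $ i) = norm (column (\<iota> i0) ?G $ i)"
      have cj: "c $ j \<noteq> 0" using c by auto
      define y z where "y = column (\<iota> i0) M" and "z = (\<Sum>l\<in>UNIV. c $ l *s column (\<iota> l) ?G)"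
      have col: "column (\<iota> l) ?G = (if l = j then column (\<iota> j) M + v else column (\<iota> l) M)" for l
        by (simp add: column_add column_column_matrix inj_\<iota>)
      have yz: "norm (z $ i) = norm (y $ i)" for i
        using eq that by (auto simp: z_def y_def col)
      \<comment> \<open>Where \<open>y\<close> and \<open>z\<close> both vanish, any unimodular factor does.\<close>
      define D where "D i = (if y $ i = 0 then 1 else z $ i / y $ i)" for i
      have D: "norm (D i) = 1" "D i * y $ i = z $ i" for i
        using yz[of i] by (auto simp: D_def norm_divide)
      have "z = c $ j *s (column (\<iota> j) M + v) + (\<Sum>l\<in>UNIV - {j}. c $ l *s column (\<iota> l) M)"
        unfolding z_def by (subst sum.remove[of _ j]) (auto simp: col intro!: sum.cong)
      then have "inverse (c $ j) *s z = column (\<iota> j) M + v + inverse (c $ j) *s (\<Sum>l\<in>UNIV - {j}. c $ l *s column (\<iota> l) M)"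
        using cj by (simp add: vector_add_ldistrib vector_smult_assoc)
      then have "column (\<iota> j) M + v = inverse (c $ j) *s z - inverse (c $ j) *s (\<Sum>l\<in>UNIV - {j}. c $ l *s column (\<iota> l) M)"
        by simp
      also have "\<dots> = (\<Sum>l\<in>UNIV - {j}. (- (inverse (c $ j) * c $ l)) *s column (\<iota> l) M) + inverse (c $ j) *s z"
        by (simp add: vec.scale_sum_right vector_smult_assoc vector_smult_lneg sum_negf)
      finally have "column (\<iota> j) M + v \<in> modulated_combinations ?w j"
        unfolding modulated_combinations_def
        by (intro CollectI exI[of _ "\<chi> l. if l = j then inverse (c $ j) else - (inverse (c $ j) * c $ l)"] exI[of _ D])
          (auto simp: D y_def[symmetric] intro!: sum.cong)
      then show "v \<in> (+) (- column (\<iota> j) M) ` modulated_combinations ?w j"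
        by (intro image_eqI[of _ _ "column (\<iota> j) M + v"]) auto
    qed
    then show "negligible {v. M + column_matrix (\<iota> j) v \<in> ?B}"
      by (rule negligible_subset[rotated]) (intro negligible_translation negl)
  qed

  have "norm x0 = norm (of_real (norm x0) *s axis i0 (1::'k))" by (simp add: vec_norm_scale norm_axis_one)
  then obtain R :: "'k^'n^'n" where R: "unitary_matrix R" "R *v x0 = of_real (norm x0) *s axis i0 1"
    using householder by blast
  define E :: "'k^'n^'m" where "E = (\<chi> i j. if i = \<iota> j then 1 else 0)"
  have E_axis: "E *v axis j 1 = axis (\<iota> j) 1" for j
    by (simp only: matrix_vector_mult_axis) (simp add: column_def E_def axis_def vec_eq_iff)
  have "standardized E"
    by (rule standardizedI) (simp add: E_axis, simp add: axis_def inj_\<iota>)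
  then have A0: "standardized (E ** R)" using R(1) by (intro standardized_mult unitary_imp_standardized)
  have E_supp: "(E *v u) $ i = 0" if "CARD('n) \<le> rk i" for u i
  proof -
    have "i \<noteq> \<iota> l" for l using that f_less[of l] rk_\<iota>[of l] by auto
    then show ?thesis by (simp add: matrix_vector_mult_def E_def)
  qed

  have "AE G in lborel. \<forall>j\<in>- {i0}. \<forall>p. G \<notin> {G :: 'k^'m^'m. \<exists>c. inverse (real (Suc p)) \<le> norm (c $ j)
      \<and> (\<forall>i. norm ((\<Sum>l\<in>UNIV. c $ l *s column (\<iota> l) G) $ i) = norm (column (\<iota> i0) G $ i))}"
    by (intro AE_finite_allI AE_all_countable[THEN iffD2] allI AE_not_in B_null) auto
  with AE_unitary_gram_schmidt AE_gs_vec_nonzero[of "\<iota> i0"]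
  have "AE G in lborel. gram_schmidt G ** (E ** R) \<notin> phase_ambiguous x0"
  proof eventually_elim
    case (elim G)
    let ?Q = "gram_schmidt G"
    show "?Q ** (E ** R) \<notin> phase_ambiguous x0"
    proof
      assume "?Q ** (E ** R) \<in> phase_ambiguous x0"
      then obtain x where x: "\<nexists>c. x = c *s x0"
        and eq: "\<forall>i. norm ((?Q *v (E *v (R *v x))) $ i) = norm ((?Q *v (E *v (R *v x0))) $ i)"
        by (auto simp: phase_ambiguous_def matrix_vector_mul_assoc[symmetric])
      define g where "g = column (\<iota> i0) G"
      have g: "gs_vec G (rk (\<iota> i0)) = g" by (simp add: rk_\<iota> i0 gs_vec_def g_def e0)
      define s where "s = norm x0 / norm g"
      have "g \<noteq> 0" using elim(2) g by simp
      then have "s > 0" using x0 by (simp add: s_def)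
      have Qx0: "?Q *v (E *v (R *v x0)) = of_real s *s g"
      proof -
        have "?Q *v (E *v (R *v x0)) = of_real (norm x0) *s (?Q *v axis (\<iota> i0) 1)"
          unfolding R(2) vector_scalar_commute E_axis ..
        then show ?thesis
          by (simp add: matrix_vector_mult_axis column_gram_schmidt g of_real_scale)
            (simp add: s_def divide_inverse)
      qed
      obtain d where d: "\<And>j. CARD('n) \<le> rk j \<Longrightarrow> d $ j = 0" "?Q *v (E *v (R *v x)) = G *v d"
        using gram_schmidt_mult_vec[OF le E_supp] by metis
      have "G *v d = (\<Sum>j\<in>range \<iota>. d $ j *s column j G)"
        unfolding mult_vec_eq_sum_columns[of G]
        by (rule sum.mono_neutral_right) (auto simp: d(1) not_less dest: range_\<iota> intro!: leI d(1))
      also have "\<dots> = (\<Sum>l\<in>UNIV. d $ \<iota> l *s column (\<iota> l) G)"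
        by (subst sum.reindex) (auto simp: inj_def inj_\<iota>)
      finally have Gd: "?Q *v (E *v (R *v x)) = (\<Sum>l\<in>UNIV. d $ \<iota> l *s column (\<iota> l) G)" by (simp add: d(2))
      obtain j where j: "j \<noteq> i0" "d $ \<iota> j \<noteq> 0"
      proof (rule ccontr)
        assume "\<not> thesis"
        with that have "d $ \<iota> l = 0" if "l \<noteq> i0" for l using \<open>l \<noteq> i0\<close> by blast
        then have "(\<Sum>l\<in>UNIV. d $ \<iota> l *s column (\<iota> l) G) = d $ \<iota> i0 *s g"
          by (subst sum.remove[of _ i0]) (auto simp: g_def intro!: sum.neutral)
        also have "\<dots> = (d $ \<iota> i0 / of_real s) *s (?Q *v (E *v (R *v x0)))"
          using \<open>s > 0\<close> by (simp add: Qx0 vector_smult_assoc)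
        finally have "?Q *v (E *v (R *v (x - (d $ \<iota> i0 / of_real s) *s x0))) = 0"
          by (simp add: Gd matrix_vector_mult_diff_distrib vector_scalar_commute)
        then have "norm (x - (d $ \<iota> i0 / of_real s) *s x0) = 0"
          using standardized_norm[OF unitary_imp_standardized[OF elim(1)]]
            standardized_norm[OF \<open>standardized E\<close>] standardized_norm[OF unitary_imp_standardized[OF R(1)]]
          by (metis norm_zero)
        then show False using x by simp
      qed
      \<comment> \<open>Rescaled so that the combination with these coefficients has the entrywise moduli of \<open>g\<close>.\<close>
      define c :: "'k^'n" where "c = (\<chi> l. d $ \<iota> l / of_real s)"
      have "c $ j \<noteq> 0" using j \<open>s > 0\<close> by (simp add: c_def)
      then obtain p where p: "inverse (real (Suc p)) < norm (c $ j)"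
        using reals_Archimedean[of "norm (c $ j)"] by auto
      have "(\<Sum>l\<in>UNIV. c $ l *s column (\<iota> l) G) = of_real (inverse s) *s (?Q *v (E *v (R *v x)))"
        by (simp add: Gd c_def vec.scale_sum_right vector_smult_assoc divide_inverse mult.commute)
      then have "norm ((\<Sum>l\<in>UNIV. c $ l *s column (\<iota> l) G) $ i) = norm (column (\<iota> i0) G $ i)" for i
        using eq \<open>s > 0\<close> by (simp add: Qx0 norm_mult norm_inverse g_def)
      then have "G \<in> {G :: 'k^'m^'m. \<exists>c. inverse (real (Suc p)) \<le> norm (c $ j)
          \<and> (\<forall>i. norm ((\<Sum>l\<in>UNIV. c $ l *s column (\<iota> l) G) $ i) = norm (column (\<iota> i0) G $ i))}"
        using p by (intro CollectI exI[of _ c]) simp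
      then show False using elim(3) j(1) by blast
    qed
  qed
  then show ?thesis
    by (rule AE_stiefel_haar_if_AE_gram_schmidt[OF haar A0 borel_phase_ambiguous])
qed

end

text \<open>
  If there is one column only, all vectors are multiples of \<open>x0\<close> and no ambiguity can occur, so the
  dimension count is required for at least two columns.
\<close>

lemma AE_minimizer_iff:
  fixes x0 :: "'k::rc_field^'n" and A :: "'w \<Rightarrow> 'k^'n^'m"
  assumes x0: "x0 \<noteq> 0" and A: "continuous_random_standardized M A"
    and le: "CARD('n) \<le> CARD('m)"
    and negl: "CARD('n) \<noteq> 1 \<Longrightarrow> (\<And>(w :: 'n \<Rightarrow> 'k^'m) j. negligible (modulated_combinations w j))"
  shows "AE \<omega> in M. \<forall>X. feasible (A \<omega>) (vec_modulus (A \<omega> *v x0)) X \<longrightarrow>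
    (global_minimizer (A \<omega>) (vec_modulus (A \<omega> *v x0)) X \<longleftrightarrow> X = outer_square x0)"
proof -
  obtain \<mu> :: "('k^'n^'m) measure" where haar: "stiefel_haar \<mu>" and meas: "A \<in> measurable M \<mu>"
    and ac: "absolutely_continuous \<mu> (distr M \<mu> A)"
    using A by (auto simp: continuous_random_standardized_def)
  have sets: "sets \<mu> = sets (restrict_space borel {A. standardized A})"
    using haar by (simp add: stiefel_haar_def)
  have space: "space \<mu> = {A. standardized A}"
    using sets_eq_imp_space_eq[OF sets] by (simp add: space_restrict_space)
  obtain rk where rk: "bij_betw rk (UNIV :: 'm set) {..<CARD('m)}"
    using ex_bij_betw_finite_nat[of "UNIV :: 'm set"] by (auto simp: lessThan_atLeast0)
  interpret column_order rk "inv_into UNIV rk"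
    using rk by unfold_locales (auto simp: bij_betw_def f_inv_into_f)
  have "AE A in \<mu>. A \<notin> phase_ambiguous x0"
  proof (cases "CARD('n) = 1")
    case True
    then obtain a :: 'n where a: "UNIV = {a}" using card_1_singletonE by blast
    have "x = (x $ a / x0 $ a) *s x0" for x
      using x0 by (auto simp: vec_eq_iff a)
        (metis (full_types) UNIV_I a divide_eq_eq singletonD vec_eq_iff zero_index)+
    then have "(phase_ambiguous x0 :: ('k^'n^'m) set) = {}" unfolding phase_ambiguous_def by blast
    then show ?thesis by simp
  next
    case False
    then show ?thesis using AE_not_phase_ambiguous[OF x0 le haar] negl by blast
  qed
  then have "AE A in \<mu>. standardized A \<and> A \<notin> phase_ambiguous x0"
    using AE_space[of \<mu>] by eventually_elim (simp add: space)
  then have "AE A in distr M \<mu> A. standardized A \<and> A \<notin> phase_ambiguous x0"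
    by (rule absolutely_continuous_AE[OF sets_distr ac])
  then have "AE \<omega> in M. standardized (A \<omega>) \<and> A \<omega> \<notin> phase_ambiguous x0"
    by (rule AE_distrD[OF meas])
  then show ?thesis
  proof eventually_elim
    case (elim \<omega>)
    then show ?case
      by (intro allI impI minimizer_iff_if_phase_retrieval x0) (auto simp: phase_ambiguous_def)
  qed
qed

theorem theorem1p8:
  fixes M :: "'w measure"
  assumes "prob_space M"
  shows
    "(\<forall>(x\<^sub>0 :: real^'n) (A :: 'w \<Rightarrow> real^'n^'m).
        x\<^sub>0 \<noteq> 0 \<and> CARD('m) \<ge> 2 * CARD('n) - 1 \<and> continuous_random_standardized M A \<longrightarrow>
        (AE \<omega> in M. \<forall>X. feasible (A \<omega>) (vec_modulus (A \<omega> *v x\<^sub>0)) X \<longrightarrow>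
           (global_minimizer (A \<omega>) (vec_modulus (A \<omega> *v x\<^sub>0)) X \<longleftrightarrow> X = outer_square x\<^sub>0))) \<and>
     (\<forall>(x\<^sub>0 :: complex^'n) (A :: 'w \<Rightarrow> complex^'n^'m).
        x\<^sub>0 \<noteq> 0 \<and> CARD('m) \<ge> 4 * CARD('n) - 2 \<and> continuous_random_standardized M A \<longrightarrow>
        (AE \<omega> in M. \<forall>X. feasible (A \<omega>) (vec_modulus (A \<omega> *v x\<^sub>0)) X \<longrightarrow>
           (global_minimizer (A \<omega>) (vec_modulus (A \<omega> *v x\<^sub>0)) X \<longleftrightarrow> X = outer_square x\<^sub>0)))"
proof (intro conjI allI impI; elim conjE)
  have pos: "CARD('n) > 0" by simp
  fix x\<^sub>0 :: "real^'n" and A :: "'w \<Rightarrow> real^'n^'m"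
  assume card: "CARD('m) \<ge> 2 * CARD('n) - 1" and *: "x\<^sub>0 \<noteq> 0" "continuous_random_standardized M A"
  have "CARD('n) \<le> CARD('m)" using card pos by linarith
  moreover have "CARD('n) < CARD('m)" if "CARD('n) \<noteq> 1" using card pos that by linarith
  ultimately show "AE \<omega> in M. \<forall>X. feasible (A \<omega>) (vec_modulus (A \<omega> *v x\<^sub>0)) X \<longrightarrow>
           (global_minimizer (A \<omega>) (vec_modulus (A \<omega> *v x\<^sub>0)) X \<longleftrightarrow> X = outer_square x\<^sub>0)"
    by (intro AE_minimizer_iff * negligible_modulated_combinations_real)
next
  have pos: "CARD('n) > 0" by simp
  fix x\<^sub>0 :: "complex^'n" and A :: "'w \<Rightarrow> complex^'n^'m"
  assume card: "CARD('m) \<ge> 4 * CARD('n) - 2" and *: "x\<^sub>0 \<noteq> 0" "continuous_random_standardized M A"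
  have "CARD('n) \<le> CARD('m)" using card pos by linarith
  moreover have "2 * CARD('n) < CARD('m)" if "CARD('n) \<noteq> 1" using card pos that by linarith
  ultimately show "AE \<omega> in M. \<forall>X. feasible (A \<omega>) (vec_modulus (A \<omega> *v x\<^sub>0)) X \<longrightarrow>
           (global_minimizer (A \<omega>) (vec_modulus (A \<omega> *v x\<^sub>0)) X \<longleftrightarrow> X = outer_square x\<^sub>0)"
    by (intro AE_minimizer_iff * negligible_modulated_combinations_complex)
qed

end
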